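(* Let $k$ be an algebraically closed field of characteristic zero, $R=k[x_1,x_2]$, $S=k[y_1,y_2]$. Let $\underline h=(h_0,h_1,\dots)$ be a level Hilbert function of type $t$ and socle degree $d$, and let $\Lambda\subseteq S_d$ be a $t$-dimensional subspace such that $R/\mathrm{ann}(\Lambda)$ has Hilbert function $\underline h$. Put $e_i=2h_{i-1}-h_{i-2}-h_i$ for $1\le i\le d+1$ (with $h_{-1}=0$), and let $q_1\le q_2\le\dots\le q_{t+1}$ be the nondecreasing sequence in which each integer $i$ with $1\le i\le d+1$ occurs exactly $e_i$ times. Then there exist secant $(q_i-1)$-planes $\Pi_{q_i}$ to the rational normal curve $C_d\subseteq\mathbf P S_d$, $1\le i\le t+1$, such that $$\mathbf P\Lambda=\Pi_{q_1}\cap\dots\cap\Pi_{q_{t+1}} .$$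
   Context: $R=k[x_1,x_2]$ acts on $S=k[y_1,y_2]$ by differentiation: $u.F=u(\partial/\partial y_1,\partial/\partial y_2)F$. For a subspace $\Lambda\subseteq S_d$, $\mathrm{ann}(\Lambda)=\{u\in R: u.F=0\ \forall F\in\Lambda\}$. A graded artin quotient $A=R/I$ with $A_d\neq0$, $A_i=0$ for $i>d$, is level of type $t$ and socle degree $d$ if $\mathrm{socle}(A)=A_d$ and $\dim_k A_d=t$; these are exactly the quotients $R/\mathrm{ann}(\Lambda)$ with $\Lambda\subseteq S_d$ of dimension $t\ge1$. The sequence $\underline h$ is a level Hilbert function of type $t$ and socle degree $d$ if $h_i=\dim_k A_i$ for all $i$ for some such $A$. (For such $\underline h$ all $e_i\ge 0$ and $\sum_{i=1}^{d+1}e_i=t+1$, so the sequence $q_1\le\dots\le q_{t+1}$ makes sense.) $\mathbf P W$ denotes the projective space of lines in $W$. $C_d=\{[L^d]: L\in S_1\setminus\{0\}\}\subseteq\mathbf P S_d\simeq\mathbf P^d$ is the rational normal curve. A linear subspace $\Pi\subseteq\mathbf P S_d$ of projective dimension $s$ is a secant $s$-plane to $C_d$ if the scheme-theoretic intersection $C_d\cap\Pi$ has length $\ge s+1$. The whole space $\mathbf P S_d$ (where $C_d\cap \Pi=C_d$ has infinite length) counts as a secant $d$-plane. *)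

theory Defs
  imports
    "HOL-Computational_Algebra.Computational_Algebra"
    "HOL-Library.Function_Algebras"
    "HOL-Library.Extended_Nat"
    "HOL-Library.Liminf_Limsup"
begin

text \<open>
  Both \<open>k[x\<^sub>1,x\<^sub>2]\<close> and \<open>k[y\<^sub>1,y\<^sub>2]\<close> are represented by \<^typ>\<open>'k poly poly\<close>: the inner variable is
  the first one, the outer variable the second one, so that \<open>coeff (coeff F j) i\<close> is the coefficient
  of \<open>y\<^sub>1\<^sup>i y\<^sub>2\<^sup>j\<close>.
\<close>

definition bscale :: "'k::field \<Rightarrow> 'k poly poly \<Rightarrow> 'k poly poly"
  where "bscale c F = smult [:c:] F"

global_interpretation bp: vector_space bscale
  by unfold_locales
    (simp_all add: bscale_def smult_add_right smult_add_left[symmetric] mult.commute flip: one_pCons)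

definition bforms :: "nat \<Rightarrow> 'k::field poly poly set"
  where "bforms n = {F. \<forall>i j. coeff (coeff F j) i \<noteq> 0 \<longrightarrow> i + j = n}"

definition bcomponent :: "nat \<Rightarrow> 'k::field poly poly \<Rightarrow> 'k poly poly"
  where "bcomponent n F = (\<Sum>j\<le>n. monom (monom (coeff (coeff F j) (n - j)) (n - j)) j)"

definition bact :: "'k::field poly poly \<Rightarrow> 'k poly poly \<Rightarrow> 'k poly poly"
  where "bact u F = (\<Sum>j\<le>degree u. \<Sum>i\<le>degree (coeff u j).
           bscale (coeff (coeff u j) i) ((map_poly pderiv ^^ i) ((pderiv ^^ j) F)))"

definition ann :: "'k::field poly poly set \<Rightarrow> 'k poly poly set"
  where "ann \<Lambda> = {u. \<forall>F\<in>\<Lambda>. bact u F = 0}"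


text \<open>
  For a subspace \<open>W\<close>, \<open>quot_dim scale V W\<close> is the dimension of the image of \<open>V\<close> in the quotient by \<open>W\<close>:
  the cardinality of a set \<open>B \<subseteq> V\<close> whose cosets form a basis of \<open>(V + W)/W\<close>. As for \<open>dim\<close>, the value
  is 0 in the infinite-dimensional case.
\<close>

definition basis_mod ::
    "('k::field \<Rightarrow> 'b::ab_group_add \<Rightarrow> 'b) \<Rightarrow> 'b set \<Rightarrow> 'b set \<Rightarrow> 'b set \<Rightarrow> bool"
  where "basis_mod scale V W B \<longleftrightarrow> B \<subseteq> V \<and> V \<subseteq> module.span scale (B \<union> W) \<and>
           (\<forall>T c. finite T \<and> T \<subseteq> B \<and> (\<Sum>b\<in>T. scale (c b) b) \<in> W \<longrightarrow> (\<forall>b\<in>T. c b = 0))"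

definition quot_dim ::
    "('k::field \<Rightarrow> 'b::ab_group_add \<Rightarrow> 'b) \<Rightarrow> 'b set \<Rightarrow> 'b set \<Rightarrow> nat"
  where "quot_dim scale V W = card (SOME B. basis_mod scale V W B)"


definition homogeneous_ideal :: "'k::field poly poly set \<Rightarrow> bool"
  where "homogeneous_ideal I \<longleftrightarrow>
           0 \<in> I \<and> (\<forall>u\<in>I. \<forall>v\<in>I. u + v \<in> I) \<and> (\<forall>u. \<forall>v\<in>I. u * v \<in> I) \<and>
           (\<forall>u\<in>I. \<forall>n. bcomponent n u \<in> I)"

definition hilbert_function :: "'k::field poly poly set \<Rightarrow> nat \<Rightarrow> nat"
  where "hilbert_function I i = quot_dim bscale (bforms i) I"

text \<open>The preimage in \<open>R\<close> of the socle of \<open>R/I\<close>, i.e. of the elements killed by the ideal \<open>(x\<^sub>1,x\<^sub>2)\<close>.\<close>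

definition socle_preimage :: "'k::field poly poly set \<Rightarrow> 'k poly poly set"
  where "socle_preimage I = {u. \<forall>v. coeff (coeff v 0) 0 = 0 \<longrightarrow> v * u \<in> I}"

text \<open>\<open>R/I\<close> is a graded artin quotient that is level of type \<open>t\<close> and socle degree \<open>d\<close>.\<close>

definition level_quotient :: "nat \<Rightarrow> nat \<Rightarrow> 'k::field poly poly set \<Rightarrow> bool"
  where "level_quotient t d I \<longleftrightarrow>
           homogeneous_ideal I \<and>
           \<not> bforms d \<subseteq> I \<and> (\<forall>i>d. bforms i \<subseteq> I) \<and>
           socle_preimage I = {u + v |u v. u \<in> bforms d \<and> v \<in> I} \<and>
           hilbert_function I d = t"

definition level_hilbert_function :: "'k::field itself \<Rightarrow> nat \<Rightarrow> nat \<Rightarrow> (nat \<Rightarrow> nat) \<Rightarrow> bool"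
  where "level_hilbert_function _ t d h \<longleftrightarrow>
           (\<exists>I :: 'k poly poly set. level_quotient t d I \<and> (\<forall>i. h i = hilbert_function I i))"

text \<open>\<open>e\<^sub>i = 2 h\<^sub>i\<^sub>-\<^sub>1 - h\<^sub>i\<^sub>-\<^sub>2 - h\<^sub>i\<close> for \<open>i \<ge> 1\<close>, where \<open>h\<^sub>-\<^sub>1 = 0\<close>.\<close>

definition ediff :: "(nat \<Rightarrow> nat) \<Rightarrow> nat \<Rightarrow> int"
  where "ediff h i = 2 * int (h (i - 1)) - (if i \<ge> 2 then int (h (i - 2)) else 0) - int (h i)"


text \<open>Points of a projective space are lines, and \<open>PP W\<close> is the set of lines in \<open>W\<close>.\<close>

definition line :: "'k::field poly poly \<Rightarrow> 'k poly poly set"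
  where "line F = bp.span {F}"

definition PP :: "'k::field poly poly set \<Rightarrow> 'k poly poly set set"
  where "PP W = {line F |F. F \<in> W \<and> F \<noteq> 0}"

definition rational_normal_curve :: "nat \<Rightarrow> 'k::field poly poly set set"
  where "rational_normal_curve d = {line (L ^ d) |L. L \<in> bforms 1 \<and> L \<noteq> 0}"


text \<open>
  The homogeneous coordinate ring of \<open>PP (bforms d)\<close> in degree \<open>n\<close>, as polynomial functions of the
  \<open>d + 1\<close> coefficients of a form (over an infinite field these are the same as polynomials).
\<close>

definition fscale :: "'k::field \<Rightarrow> ('b \<Rightarrow> 'k) \<Rightarrow> 'b \<Rightarrow> 'k"
  where "fscale c f = (\<lambda>x. c * f x)"

global_interpretation fn: vector_space fscale
  by unfold_locales (auto simp: fscale_def fun_eq_iff algebra_simps)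

definition coord_forms :: "nat \<Rightarrow> nat \<Rightarrow> ('k::field poly poly \<Rightarrow> 'k) set"
  where "coord_forms d n =
           fn.span {(\<lambda>F. \<Prod>i\<le>d. coeff (coeff F (d - i)) i ^ m i) |m. (\<Sum>i\<le>d. m i) = n}"

text \<open>The degree-\<open>n\<close> part of the homogeneous ideal of a set of points of \<open>PP (bforms d)\<close>.\<close>

definition vanishing_forms ::
    "nat \<Rightarrow> 'k::field poly poly set set \<Rightarrow> nat \<Rightarrow> ('k poly poly \<Rightarrow> 'k) set"
  where "vanishing_forms d X n = {f \<in> coord_forms d n. \<forall>l\<in>X. \<forall>F\<in>l. f F = 0}"

text \<open>
  The scheme-theoretic intersection of two (reduced) closed subvarieties \<open>X\<close>, \<open>Y\<close> is the closed
  subscheme defined by the sum of their homogeneous ideals \<open>I(X) + I(Y)\<close>. Its length is the value in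
  large degrees of the Hilbert function of the coordinate ring modulo \<open>I(X) + I(Y)\<close>. The Hilbert
  function tends to infinity if the scheme has positive dimension, so that the limit inferior is the
  length in all cases (\<open>\<infinity>\<close> if the length is infinite).
\<close>

definition intersection_length ::
    "nat \<Rightarrow> 'k::field poly poly set set \<Rightarrow> 'k poly poly set set \<Rightarrow> enat"
  where "intersection_length d X Y =
           liminf (\<lambda>n. enat (quot_dim fscale (coord_forms d n)
             {f + g |f g. f \<in> vanishing_forms d X n \<and> g \<in> vanishing_forms d Y n}))"

definition secant_plane :: "nat \<Rightarrow> nat \<Rightarrow> 'k::field poly poly set set \<Rightarrow> bool"
  where "secant_plane d s P \<longleftrightarrow>
           (\<exists>V. bp.subspace V \<and> V \<subseteq> bforms d \<and> bp.dim V = s + 1 \<and> P = PP V) \<and>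
           intersection_length d (rational_normal_curve d) P \<ge> enat (s + 1)"

end

theory Submission
  imports Defs
begin

text \<open>
  Contraction gives a perfect pairing between \<open>R\<^sub>d\<close> and \<open>S\<^sub>d\<close> under which \<open>\<Lambda>\<close> is the orthogonal
  complement of \<open>I\<^sub>d\<close>, where \<open>I = ann \<Lambda>\<close>. Levelness of \<open>R/I\<close> and the Koszul syzygy of \<open>x\<^sub>1, x\<^sub>2\<close> show that
  \<open>e\<^sub>i\<close> is the number of minimal generators of \<open>I\<close> in degree \<open>i\<close>. So \<open>\<Lambda>\<close> is the intersection of the
  spaces \<open>(uR)\<^sub>d\<^sup>\<bottom>\<close>, \<open>u\<close> running over minimal generators of degrees \<open>q\<^sub>1, \<dots>, q\<^sub>t\<^sub>+\<^sub>1\<close>.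

  For a form \<open>u\<close> of degree \<open>q \<le> d + 1\<close>, the space \<open>(uR)\<^sub>d\<^sup>\<bottom>\<close> has dimension \<open>q\<close> and is secant, whether or
  not \<open>u\<close> has multiple roots: restricting a degree \<open>n\<close> form \<open>f\<close> on \<open>PP S\<^sub>d\<close> to the curve gives an element
  of \<open>R\<^sub>d\<^sub>n\<close>, and if \<open>f\<close> vanishes on \<open>(uR)\<^sub>d\<^sup>\<bottom>\<close> then its restriction is divisible by \<open>u\<close>, because modulo \<open>u\<close> the
  generic point of the curve is an \<open>R\<close>-linear combination of points of \<open>(uR)\<^sub>d\<^sup>\<bottom>\<close>. Hence the length
  of the intersection is at least \<open>dim R\<^sub>d\<^sub>n/(uR)\<^sub>d\<^sub>n = q\<close>.
\<close>

section \<open>Dimensions modulo a subspace\<close>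

context vector_space
begin

lemma basis_modD:
  assumes "basis_mod scale V W B"
  shows "B \<subseteq> V" "V \<subseteq> span (B \<union> W)"
    "\<And>T c b. finite T \<Longrightarrow> T \<subseteq> B \<Longrightarrow> (\<Sum>b\<in>T. scale (c b) b) \<in> W \<Longrightarrow> b \<in> T \<Longrightarrow> c b = 0"
  using assms unfolding basis_mod_def by auto

text \<open>A combination of \<open>B - C\<close> lying in \<open>W\<close> also lies in
  \<open>V\<close>, hence in the span of \<open>C\<close>; independence of \<open>B\<close> then
  kills its coefficients.\<close>

lemma basis_mod_of_extended_basis:
  assumes V: "subspace V" and W: "subspace W"
    and C: "C \<subseteq> V \<inter> W" "V \<inter> W \<subseteq> span C"
    and B: "C \<subseteq> B" "B \<subseteq> V" "independent B" "V \<subseteq> span B"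
  shows "basis_mod scale V W (B - C)"
proof -
  have "span B \<subseteq> span (B - C \<union> W)"
    using C by (intro span_mono) auto
  moreover have "c b = 0"
    if T: "finite T" "T \<subseteq> B - C" "(\<Sum>b\<in>T. scale (c b) b) \<in> W" "b \<in> T" for T c b
  proof -
    have "(\<Sum>b\<in>T. scale (c b) b) \<in> V"
      using T B by (intro subspace_sum[OF V] subspace_scale[OF V]) auto
    then have "(\<Sum>b\<in>T. scale (c b) b) \<in> span C"
      using T C by auto
    then obtain t r where t: "finite t" "t \<subseteq> C" "(\<Sum>b\<in>T. scale (c b) b) = (\<Sum>a\<in>t. scale (r a) a)"
      by (auto simp: span_explicit)
    \<comment> \<open>Moving the \<open>C\<close>-part to the other side gives one vanishing
      combination over the disjoint union of \<open>T\<close> and \<open>t\<close>.\<close>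
    define u where "u = (\<lambda>x. if x \<in> T then c x else - r x)"
    have disj: "T \<inter> t = {}"
      using T t by auto
    have "(\<Sum>x\<in>T \<union> t. scale (u x) x) = (\<Sum>x\<in>T. scale (u x) x) + (\<Sum>x\<in>t. scale (u x) x)"
      using T t disj by (intro sum.union_disjoint) auto
    also have "(\<Sum>x\<in>T. scale (u x) x) = (\<Sum>x\<in>T. scale (c x) x)"
      by (intro sum.cong) (auto simp: u_def)
    also have "(\<Sum>x\<in>t. scale (u x) x) = - (\<Sum>x\<in>t. scale (r x) x)"
      unfolding sum_negf[symmetric] using disj by (intro sum.cong) (auto simp: u_def)
    finally have "(\<Sum>x\<in>T \<union> t. scale (u x) x) = 0"
      using t by simp
    then have "u b = 0"
      using independentD[OF B(3), of "T \<union> t" u b] T t B by auto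
    then show ?thesis
      using T by (simp add: u_def)
  qed
  ultimately show ?thesis
    unfolding basis_mod_def using B by (intro conjI allI impI ballI) auto
qed

text \<open>Ensures that the choice in \<open>quot_dim\<close> picks an actual basis rather than an
  arbitrary set.\<close>

lemma basis_mod_exists:
  assumes "subspace V" "subspace W"
  obtains B where "basis_mod scale V W B"
proof -
  obtain C where C: "C \<subseteq> V \<inter> W" "independent C" "V \<inter> W \<subseteq> span C"
    using basis_exists[of "V \<inter> W"] by metis
  obtain B where B: "C \<subseteq> B" "B \<subseteq> V" "independent B" "V \<subseteq> span B"
    using maximal_independent_subset_extend[of C V] C by auto
  show ?thesis
    using that basis_mod_of_extended_basis[OF assms C(1,3) B] .
qed

text \<open>In a vanishing combination the part over \<open>B\<close> is minus a combination of
  \<open>C\<close>, so it lies in \<open>W\<close> and its coefficients vanish; independence of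
  \<open>C\<close> handles the rest.\<close>

lemma independent_if_independent_mod:
  assumes "W = span C" "independent C"
    and indep: "\<And>T c b. finite T \<Longrightarrow> T \<subseteq> B \<Longrightarrow> (\<Sum>b\<in>T. scale (c b) b) \<in> W \<Longrightarrow> b \<in> T \<Longrightarrow> c b = 0"
  shows "independent (B \<union> C)" "B \<inter> C = {}"
proof -
  show disj: "B \<inter> C = {}"
  proof (rule ccontr)
    assume "B \<inter> C \<noteq> {}"
    then obtain b where "b \<in> B" "b \<in> C"
      by auto
    then show False
      using indep[of "{b}" "\<lambda>_. 1" b] assms(1) by (simp add: span_base)
  qed
  show "independent (B \<union> C)"
    unfolding independent_explicit_finite_subsets
  proof (intro allI impI ballI)
    fix S u v
    assume S: "S \<subseteq> B \<union> C" "finite S" "(\<Sum>v\<in>S. scale (u v) v) = 0" "v \<in> S"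
    have split: "(\<Sum>v\<in>S. scale (u v) v) = (\<Sum>v\<in>S \<inter> B. scale (u v) v) + (\<Sum>v\<in>S - B. scale (u v) v)"
      using S(2) by (rule sum.Int_Diff)
    have "(\<Sum>v\<in>S - B. scale (u v) v) \<in> span C"
      using S by (intro span_sum span_scale span_base) auto
    moreover have "(\<Sum>v\<in>S \<inter> B. scale (u v) v) = - (\<Sum>v\<in>S - B. scale (u v) v)"
      using S(3) unfolding eq_neg_iff_add_eq_0 split .
    ultimately have "(\<Sum>v\<in>S \<inter> B. scale (u v) v) \<in> W"
      using assms(1) by (simp add: span_neg)
    then have zero: "u b = 0" if "b \<in> S \<inter> B" for b
      using indep[of "S \<inter> B" u b] S that by auto
    have "(\<Sum>v\<in>S \<inter> B. scale (u v) v) = 0"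
      using zero by (intro sum.neutral) auto
    then have "(\<Sum>v\<in>S - B. scale (u v) v) = 0"
      using S(3) unfolding split by simp
    then have "u b = 0" if "b \<in> S - B" for b
      using independentD[OF assms(2), of "S - B" u b] S that by auto
    with zero show "u v = 0"
      using S by blast
  qed
qed

text \<open>\<open>B\<close> and a basis of the intersection of \<open>V\<close> and
  \<open>W\<close> together form a basis of \<open>V\<close>; the finite spanning set makes the
  cardinalities genuine.\<close>

lemma basis_mod_card:
  assumes V: "subspace V" and W: "subspace W" and F: "finite F" "V \<subseteq> span F"
    and B: "basis_mod scale V W B"
  shows "finite B" "card B + dim (V \<inter> W) = dim V"
proof -
  note B = basis_modD[OF B]
  obtain C where C: "C \<subseteq> V \<inter> W" "independent C" "V \<inter> W \<subseteq> span C" "card C = dim (V \<inter> W)"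
    using basis_exists[of "V \<inter> W"] by metis
  have VW: "subspace (V \<inter> W)"
    using V W by (rule subspace_inter)
  have eq: "V \<inter> W = span C"
    using C span_minimal[OF C(1) VW] by blast
  have indep: "c b = 0" if "finite T" "T \<subseteq> B" "(\<Sum>b\<in>T. scale (c b) b) \<in> V \<inter> W" "b \<in> T" for T c b
    using B(3)[of T c b] that by auto
  have BC: "independent (B \<union> C)" "B \<inter> C = {}"
    by (rule independent_if_independent_mod[OF eq C(2)], erule (3) indep)+
  have "B \<union> C \<subseteq> span F"
    using B C F by blast
  then have fin: "finite (B \<union> C)"
    using independent_span_bound[OF F(1) BC(1)] by blast
  then show "finite B"
    by simp
  have "V \<subseteq> span (B \<union> C)"
  proof
    fix v assume v: "v \<in> V"
    then obtain x w where xw: "v = x + w" "x \<in> span B" "w \<in> W"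
      using B(2) W unfolding span_Un by (auto simp: span_eq_iff[THEN iffD2])
    have "x \<in> V"
      using xw(2) B(1) span_minimal[OF B(1) V] by blast
    then have "w \<in> V \<inter> W"
      using xw v V subspace_diff[OF V v, of x] by auto
    then show "v \<in> span (B \<union> C)"
      using xw eq unfolding span_Un by auto
  qed
  then have "card (B \<union> C) = dim V"
    using BC B C by (intro basis_card_eq_dim) auto
  then show "card B + dim (V \<inter> W) = dim V"
    using fin BC(2) C(4) by (simp add: card_Un_disjoint)
qed

lemma quot_dim_plus_dim:
  assumes "subspace V" "subspace W" "finite F" "V \<subseteq> span F"
  shows "quot_dim scale V W + dim (V \<inter> W) = dim V"
proof -
  obtain B where "basis_mod scale V W B"
    using basis_mod_exists[OF assms(1,2)] .
  then have "basis_mod scale V W (SOME B. basis_mod scale V W B)"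
    by (rule someI)
  then show ?thesis
    unfolding quot_dim_def using basis_mod_card(2)[OF assms] by blast
qed

text \<open>A basis \<open>D\<close> of \<open>A\<close> modulo \<open>B\<close> is also a basis of
  \<open>A + B\<close> modulo \<open>B\<close>; counting \<open>D\<close> in both ways gives the
  formula.\<close>

lemma dim_sums_Int:
  assumes A: "subspace A" "finite F" "A \<subseteq> span F" and B: "subspace B" "finite G" "B \<subseteq> span G"
  shows "dim {x + y |x y. x \<in> A \<and> y \<in> B} + dim (A \<inter> B) = dim A + dim B"
proof -
  let ?S = "{x + y |x y. x \<in> A \<and> y \<in> B}"
  obtain D where D: "basis_mod scale A B D"
    using basis_mod_exists[OF A(1) B(1)] .
  have AS: "A \<subseteq> ?S" and BS: "B \<subseteq> ?S"
    using subspace_0[OF A(1)] subspace_0[OF B(1)] by force+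
  have "x + y \<in> span (D \<union> B)" if "x \<in> A" "y \<in> B" for x y
    using that basis_modD(2)[OF D] by (intro span_add[of x] span_base[of y]) auto
  then have SD: "?S \<subseteq> span (D \<union> B)"
    by blast
  have "D \<subseteq> ?S"
    using basis_modD(1)[OF D] AS by (rule subset_trans)
  then have DS: "basis_mod scale ?S B D"
    using SD D unfolding basis_mod_def by (elim conjE) (intro conjI)
  have "x + y \<in> span (F \<union> G)" if "x \<in> A" "y \<in> B" for x y
    using that A(3) B(3) span_mono[of F "F \<union> G"] span_mono[of G "F \<union> G"]
    by (intro span_add[of x]) auto
  then have "?S \<subseteq> span (F \<union> G)"
    by blast
  then have "card D + dim (?S \<inter> B) = dim ?S"
    using basis_mod_card(2)[OF subspace_sums[OF A(1) B(1)] B(1) _ _ DS, of "F \<union> G"] A B by simp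
  moreover have "card D + dim (A \<inter> B) = dim A"
    using basis_mod_card(2)[OF A(1) B(1) A(2,3) D] .
  moreover have "?S \<inter> B = B"
    using BS by blast
  ultimately show ?thesis
    by simp
qed

text \<open>The image of \<open>D\<close> together with a basis of the intersection of
  \<open>V\<close> and \<open>W\<close> is independent, so it extends to a basis of
  \<open>V\<close>.\<close>

lemma quot_dim_ge:
  assumes V: "subspace V" and W: "subspace W" and F: "finite F" "V \<subseteq> span F"
    and D: "finite D" "f ` D \<subseteq> V"
    and indep: "\<And>c b. (\<Sum>b\<in>D. scale (c b) (f b)) \<in> W \<Longrightarrow> b \<in> D \<Longrightarrow> c b = 0"
  shows "card D \<le> quot_dim scale V W"
proof -
  have inj: "inj_on f D"
  proof (rule inj_onI, rule ccontr)
    fix x y assume xy: "x \<in> D" "y \<in> D" "f x = f y" "x \<noteq> y"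
    \<comment> \<open>Equal values at two indices would give a vanishing combination with
      coefficients 1 and -1.\<close>
    let ?c = "\<lambda>b. if b = x then 1 else if b = y then - 1 else 0"
    have "(\<Sum>b\<in>D. scale (?c b) (f b)) = (\<Sum>b\<in>{x, y}. scale (?c b) (f b))"
      using xy D by (intro sum.mono_neutral_right) auto
    also have "\<dots> = 0"
      using xy by simp
    finally show False
      using indep[of ?c x] xy subspace_0[OF W] by simp
  qed
  obtain C where C: "C \<subseteq> V \<inter> W" "independent C" "V \<inter> W \<subseteq> span C" "card C = dim (V \<inter> W)"
    using basis_exists[of "V \<inter> W"] by metis
  have eq: "V \<inter> W = span C"
    using C span_minimal[OF C(1) subspace_inter[OF V W]] by blast
  have fD: "c b = 0" if T: "finite T" "T \<subseteq> f ` D" "(\<Sum>b\<in>T. scale (c b) b) \<in> V \<inter> W" "b \<in> T" for T c b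
  proof -
    define c' where "c' = (\<lambda>x. if f x \<in> T then c (f x) else 0)"
    have "(\<Sum>x\<in>D. scale (c' x) (f x)) = (\<Sum>b\<in>f ` D. scale (if b \<in> T then c b else 0) b)"
      using inj by (simp add: sum.reindex c'_def)
    also have "\<dots> = (\<Sum>b\<in>T. scale (c b) b)"
      using T D by (intro sum.mono_neutral_cong_right) auto
    finally have "c' x = 0" if "x \<in> D" for x
      using indep[of c' x] T that by simp
    then show ?thesis
      using T by (force simp: c'_def)
  qed
  have BC: "independent (f ` D \<union> C)" "f ` D \<inter> C = {}"
    by (rule independent_if_independent_mod[OF eq C(2)], erule (3) fD)+
  obtain B where B: "f ` D \<union> C \<subseteq> B" "B \<subseteq> V" "independent B" "V \<subseteq> span B"
    using maximal_independent_subset_extend[of "f ` D \<union> C" V] BC D C by auto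
  have finB: "finite B"
    using independent_span_bound[OF F(1) B(3)] B F by blast
  have "card D + card C = card (f ` D \<union> C)"
    using BC(2) D finB B(1) inj by (subst card_Un_disjoint) (auto simp: card_image intro: finite_subset)
  also have "\<dots> \<le> card B"
    using finB B(1) by (rule card_mono)
  also have "card B = dim V"
    using B by (intro basis_card_eq_dim)
  also have "\<dots> = quot_dim scale V W + dim (V \<inter> W)"
    using quot_dim_plus_dim[OF V W F] by simp
  finally show ?thesis
    using C(4) by simp
qed

end

section \<open>Bivariate forms\<close>

abbreviation bcoeff :: "'k::zero poly poly \<Rightarrow> nat \<Rightarrow> nat \<Rightarrow> 'k"
  where "bcoeff F i j \<equiv> coeff (coeff F j) i"

definition bmonom :: "nat \<Rightarrow> nat \<Rightarrow> 'k::field poly poly"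
  where "bmonom i j = monom (monom 1 i) j"

abbreviation x\<^sub>1 :: "'k::field poly poly"
  where "x\<^sub>1 \<equiv> bmonom (Suc 0) 0"

abbreviation x\<^sub>2 :: "'k::field poly poly"
  where "x\<^sub>2 \<equiv> bmonom 0 (Suc 0)"

lemma bpoly_eqI: "(\<And>i j. bcoeff F i j = bcoeff G i j) \<Longrightarrow> F = G"
  by (simp add: poly_eq_iff)

lemma bcoeff_bscale [simp]: "bcoeff (bscale c F) i j = c * bcoeff F i j"
  by (simp add: bscale_def)

lemma bcoeff_bmonom: "bcoeff (bmonom a b) i j = (if i = a \<and> j = b then 1 else 0)"
  by (auto simp: bmonom_def)

lemma bmonom_neq_0 [simp]: "bmonom i j \<noteq> 0"
  by (simp add: bmonom_def monom_eq_0_iff)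

lemma bcoeff_mult:
  "bcoeff (u * v) i j = (\<Sum>b\<le>j. \<Sum>a\<le>i. bcoeff u a b * bcoeff v (i - a) (j - b))"
  by (simp add: coeff_mult coeff_sum)

lemma bcoeff_mult_bmonom:
  "bcoeff (bmonom a b * F) i j = (if a \<le> i \<and> b \<le> j then bcoeff F (i - a) (j - b) else 0)"
  by (auto simp: bmonom_def coeff_monom_mult)

lemma bmonom_mult: "bmonom a b * bmonom i j = bmonom (a + i) (b + j)"
  by (simp add: bmonom_def mult_monom)

lemma bmonom_0: "bmonom 0 0 = 1"
  by (simp add: bmonom_def flip: one_pCons)

lemma bscale_mult_left: "bscale c F * G = bscale c (F * G)"
  and bscale_mult_right: "F * bscale c G = bscale c (F * G)"
  by (simp_all add: bscale_def)

lemma sum_bscale_bmonom: "(\<Sum>j\<le>degree F. \<Sum>i\<le>degree (coeff F j). bscale (bcoeff F i j) (bmonom i j)) = F"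
proof -
  have "(\<Sum>i\<le>degree (coeff F j). bscale (bcoeff F i j) (bmonom i j)) = monom (coeff F j) j" for j
  proof -
    have "(\<Sum>i\<le>degree (coeff F j). bscale (bcoeff F i j) (bmonom i j))
        = (\<Sum>i\<le>degree (coeff F j). monom (monom (bcoeff F i j) i) j)"
      by (simp add: bscale_def bmonom_def smult_monom)
    also have "\<dots> = monom (\<Sum>i\<le>degree (coeff F j). monom (bcoeff F i j) i) j"
      by (rule poly_eqI) (simp add: coeff_sum)
    finally show ?thesis
      by (simp add: poly_as_sum_of_monoms)
  qed
  then show ?thesis
    by (simp add: poly_as_sum_of_monoms)
qed

lemma bformsD: "F \<in> bforms n \<Longrightarrow> i + j \<noteq> n \<Longrightarrow> bcoeff F i j = 0"
  by (auto simp: bforms_def)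

lemma subspace_bforms: "bp.subspace (bforms n)"
  by (auto simp: bp.subspace_def bforms_def) (metis add.left_neutral)

lemma bmonom_in_bforms: "i + j = n \<Longrightarrow> bmonom i j \<in> bforms n"
  by (auto simp: bforms_def bcoeff_bmonom split: if_splits)

lemma xy_in_bforms: "x\<^sub>1 \<in> bforms 1" "x\<^sub>2 \<in> bforms 1"
  by (intro bmonom_in_bforms; simp)+

lemma one_in_bforms: "1 \<in> bforms 0"
  using bmonom_in_bforms[of 0 0 0] by (simp add: bmonom_0)

lemma mult_in_bforms:
  assumes "u \<in> bforms m" "v \<in> bforms n"
  shows "u * v \<in> bforms (m + n)"
proof -
  have "bcoeff (u * v) i j = 0" if "i + j \<noteq> m + n" for i j
    unfolding bcoeff_mult
  proof (intro sum.neutral ballI)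
    fix b a assume "b \<in> {..j}" "a \<in> {..i}"
    then have "a + b \<noteq> m \<or> (i - a) + (j - b) \<noteq> n"
      using that by auto
    then show "bcoeff u a b * bcoeff v (i - a) (j - b) = 0"
      using assms by (auto simp: bformsD)
  qed
  then show ?thesis
    by (auto simp: bforms_def)
qed

lemma power_in_bforms: "u \<in> bforms m \<Longrightarrow> u ^ n \<in> bforms (m * n)"
  by (induction n) (use one_in_bforms mult_in_bforms in \<open>fastforce+\<close>)

lemma prod_in_bforms:
  "finite A \<Longrightarrow> (\<And>x. x \<in> A \<Longrightarrow> u x \<in> bforms (m x)) \<Longrightarrow> prod u A \<in> bforms (sum m A)"
  by (induction A rule: finite_induct) (auto simp: one_in_bforms mult_in_bforms)

lemma bforms_expansion:
  assumes "F \<in> bforms n"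
  shows "F = (\<Sum>i\<le>n. bscale (bcoeff F i (n - i)) (bmonom i (n - i)))"
proof (rule bpoly_eqI)
  fix a b
  have "bcoeff (\<Sum>i\<le>n. bscale (bcoeff F i (n - i)) (bmonom i (n - i))) a b
      = (\<Sum>i\<le>n. if i = a then (if b = n - a then bcoeff F a (n - a) else 0) else 0)"
    unfolding coeff_sum bcoeff_bscale by (intro sum.cong refl) (auto simp: bcoeff_bmonom)
  also have "\<dots> = bcoeff F a b"
    using assms by (auto simp: sum.delta bformsD)
  finally show "bcoeff F a b = bcoeff (\<Sum>i\<le>n. bscale (bcoeff F i (n - i)) (bmonom i (n - i))) a b" ..
qed

definition bmonoms :: "nat \<Rightarrow> 'k::field poly poly set"
  where "bmonoms n = (\<lambda>i. bmonom i (n - i)) ` {..n}"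

lemma finite_bmonoms: "finite (bmonoms n)"
  by (simp add: bmonoms_def)

lemma bforms_subset_span: "bforms n \<subseteq> bp.span (bmonoms n)"
proof
  fix F :: "'a poly poly" assume "F \<in> bforms n"
  then show "F \<in> bp.span (bmonoms n)"
    by (subst bforms_expansion, assumption)
      (intro bp.span_sum bp.span_scale bp.span_base, auto simp: bmonoms_def)
qed

lemma bmonom_inject: "bmonom a b = (bmonom i j :: 'k::field poly poly) \<longleftrightarrow> a = i \<and> b = j"
proof
  assume eq: "bmonom a b = (bmonom i j :: 'k poly poly)"
  have "bcoeff (bmonom a b :: 'k poly poly) a b = bcoeff (bmonom i j :: 'k poly poly) a b"
    by (simp only: eq)
  then show "a = i \<and> b = j"
    by (simp add: bcoeff_bmonom split: if_splits)
qed simp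

lemma inj_on_bmonom: "inj_on (\<lambda>i. bmonom i (n - i) :: 'k::field poly poly) {..n}"
  by (auto simp: inj_on_def bmonom_inject)

lemma independent_bmonoms: "bp.independent (bmonoms n :: 'k::field poly poly set)"
proof (rule bp.independent_if_scalars_zero[OF finite_bmonoms])
  fix f :: "'k poly poly \<Rightarrow> 'k" and x :: "'k poly poly"
  assume sum: "(\<Sum>x\<in>bmonoms n. bscale (f x) x) = 0" and x: "x \<in> bmonoms n"
  from x obtain k where k: "k \<le> n" "x = bmonom k (n - k)"
    by (auto simp: bmonoms_def)
  have "0 = bcoeff (\<Sum>i\<le>n. bscale (f (bmonom i (n - i))) (bmonom i (n - i))) k (n - k)"
    using sum unfolding bmonoms_def by (subst (asm) sum.reindex[OF inj_on_bmonom]) simp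
  also have "\<dots> = (\<Sum>i\<le>n. if i = k then f (bmonom k (n - k)) else 0)"
    unfolding coeff_sum bcoeff_bscale by (intro sum.cong refl) (auto simp: bcoeff_bmonom)
  finally show "f x = 0"
    using k by simp
qed

lemma bmonoms_subset: "bmonoms n \<subseteq> bforms n"
  by (auto simp: bmonoms_def intro: bmonom_in_bforms)

lemma dim_bforms: "bp.dim (bforms n :: 'k::field poly poly set) = n + 1"
proof (rule bp.dim_unique[OF bmonoms_subset bforms_subset_span independent_bmonoms])
  show "card (bmonoms n :: 'k poly poly set) = n + 1"
    unfolding bmonoms_def using card_image[OF inj_on_bmonom] by simp
qed

lemma bcoeff_bcomponent: "bcoeff (bcomponent n F) i j = (if i + j = n then bcoeff F i j else 0)"
proof -
  have "bcoeff (bcomponent n F) i j = (\<Sum>k\<le>n. if k = j then (if i = n - j then bcoeff F i j else 0) else 0)"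
    unfolding bcomponent_def coeff_sum by (intro sum.cong refl) auto
  then show ?thesis
    by (auto simp: sum.delta)
qed

lemma bcomponent_in_bforms: "bcomponent n F \<in> bforms n"
  by (auto simp: bforms_def bcoeff_bcomponent split: if_splits)

lemma bcomponent_bforms: "F \<in> bforms n \<Longrightarrow> bcomponent n F = F"
  by (rule bpoly_eqI) (auto simp: bcoeff_bcomponent bformsD)

text \<open>In the convolution only the terms with \<open>a + b = q\<close> survive, and these shift
  the degree of \<open>v\<close> by exactly \<open>q\<close>.\<close>

lemma bcomponent_mult:
  assumes "u \<in> bforms q"
  shows "bcomponent n (u * v) = (if q \<le> n then u * bcomponent (n - q) v else 0)"
proof (rule bpoly_eqI)
  fix i j
  have "(if i + j = n then bcoeff u a b * bcoeff v (i - a) (j - b) else 0)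
      = (if q \<le> n then bcoeff u a b * bcoeff (bcomponent (n - q) v) (i - a) (j - b) else 0)"
    if "b \<le> j" "a \<le> i" for a b
  proof (cases "a + b = q")
    case True
    then show ?thesis
      using that by (auto simp: bcoeff_bcomponent)
  next
    case False
    then show ?thesis
      using assms by (auto simp: bformsD)
  qed
  then have "(\<Sum>b\<le>j. \<Sum>a\<le>i. if i + j = n then bcoeff u a b * bcoeff v (i - a) (j - b) else 0)
    = (\<Sum>b\<le>j. \<Sum>a\<le>i. if q \<le> n then bcoeff u a b * bcoeff (bcomponent (n - q) v) (i - a) (j - b) else 0)"
    by (intro sum.cong refl) auto
  then show "bcoeff (bcomponent n (u * v)) i j = bcoeff (if q \<le> n then u * bcomponent (n - q) v else 0) i j"
    by (auto simp: bcoeff_bcomponent[of n] bcoeff_mult)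
qed

text \<open>Divisibility provides some cofactor, not necessarily a homogeneous one; taking the
  degree \<open>m\<close> component of the product replaces it by its component of degree
  \<open>m - q\<close>.\<close>

lemma bforms_dvdE:
  assumes "u \<in> bforms q" "w \<in> bforms m" "u dvd w"
  obtains "m < q" "w = 0" | v where "q \<le> m" "v \<in> bforms (m - q)" "w = u * v"
proof -
  obtain v where v: "w = u * v"
    using assms by auto
  then have "w = bcomponent m (u * v)"
    using assms by (simp add: bcomponent_bforms)
  then show ?thesis
    using that bcomponent_mult[OF assms(1)] bcomponent_in_bforms by (metis linorder_not_less)
qed

section \<open>Graded pieces of a principal ideal and their dimensions\<close>

definition multiples :: "nat \<Rightarrow> 'k::field poly poly \<Rightarrow> 'k poly poly set"
  where "multiples m u = {w \<in> bforms m. u dvd w}"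

lemma subspace_dvd: "bp.subspace {w. u dvd w}"
  by (auto simp: bp.subspace_def bscale_def dvd_smult)

lemma subspace_multiples: "bp.subspace (multiples m u)"
  using bp.subspace_inter[OF subspace_bforms subspace_dvd, of m u] by (simp add: multiples_def Int_def)

lemma linear_times: "Vector_Spaces.linear bscale bscale ((*) u)"
  by (auto simp: Vector_Spaces.linear_iff bscale_mult_right distrib_left bp.vector_space_axioms)

lemma subspace_times_image: "bp.subspace V \<Longrightarrow> bp.subspace ((*) u ` V)"
proof -
  assume V: "bp.subspace V"
  show ?thesis
    unfolding bp.subspace_def
  proof (intro conjI ballI allI)
    show "0 \<in> (*) u ` V"
      using bp.subspace_0[OF V] by (intro image_eqI[of _ _ 0]) simp_all
    fix a b c assume "a \<in> (*) u ` V"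
    then obtain a' where a: "a = u * a'" "a' \<in> V"
      by auto
    then show "bscale c a \<in> (*) u ` V"
      by (auto simp: bp.subspace_scale[OF V] simp flip: bscale_mult_right)
    assume "b \<in> (*) u ` V"
    then obtain b' where b: "b = u * b'" "b' \<in> V"
      by auto
    then show "a + b \<in> (*) u ` V"
      using a by (auto simp: bp.subspace_add[OF V] simp flip: distrib_left)
  qed
qed

lemma dim_times_image:
  fixes u :: "'k::field poly poly"
  assumes "u \<noteq> 0" "bp.subspace V"
  shows "bp.dim ((*) u ` V) = bp.dim V"
proof -
  interpret vector_space_pair "bscale :: 'k \<Rightarrow> _" "bscale :: 'k \<Rightarrow> _"
    by unfold_locales
  obtain B where B: "B \<subseteq> V" "bp.independent B" "V \<subseteq> bp.span B" "card B = bp.dim V"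
    using bp.basis_exists by metis
  have inj: "inj ((*) u)"
    using assms(1) by (auto simp: inj_on_def)
  show ?thesis
  proof (rule bp.dim_unique)
    show "(*) u ` B \<subseteq> (*) u ` V"
      using B by auto
    show "(*) u ` V \<subseteq> bp.span ((*) u ` B)"
      using B by (simp add: linear_spans_image[OF linear_times])
    show "bp.independent ((*) u ` B)"
      using B(2) inj by (intro linear_independent_injective_image[OF linear_times]) (auto simp: inj_on_def)
    show "card ((*) u ` B) = bp.dim V"
      using B(4) inj by (simp add: card_image inj_on_def)
  qed
qed

text \<open>Multiplication by \<open>u\<close> is an isomorphism from the forms of degree
  \<open>m - q\<close>. For \<open>q > m\<close> the truncated difference is 0, as it should
  be.\<close>

lemma dim_multiples:
  assumes "u \<in> bforms q" "u \<noteq> 0"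
  shows "bp.dim (multiples m u) = m + 1 - q"
proof (cases "q \<le> m")
  case True
  have "multiples m u = (*) u ` bforms (m - q)"
    using True assms mult_in_bforms[of u q _ "m - q"]
    by (auto simp: multiples_def elim!: bforms_dvdE[of u q _ m])
  then show ?thesis
    using True assms by (simp add: dim_times_image subspace_bforms dim_bforms)
next
  case False
  then have "multiples m u = {0}"
    using assms bp.subspace_0[OF subspace_bforms]
    by (auto simp: multiples_def elim!: bforms_dvdE[of u q _ m])
  then show ?thesis
    using False bp.dim_unique[of "{}" "{0}" 0] by (simp add: bp.dependent_def)
qed

section \<open>The contraction pairing\<close>

text \<open>For forms of degree \<open>d\<close> this is the constant v.F of the differentiation
  action: the weights are the values of a monomial operator on the matching monomial. Only
  coefficients in degree \<open>d\<close> are read.\<close>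

definition pairing :: "nat \<Rightarrow> 'k::field_char_0 poly poly \<Rightarrow> 'k poly poly \<Rightarrow> 'k"
  where "pairing d v F = (\<Sum>i\<le>d. bcoeff v i (d - i) * (fact i * fact (d - i)) * bcoeff F i (d - i))"

lemma pairing_commute: "pairing d v F = pairing d F v"
  by (simp add: pairing_def mult_ac)

lemma pairing_0_left [simp]: "pairing d 0 F = 0"
  and pairing_add_left: "pairing d (u + v) F = pairing d u F + pairing d v F"
  and pairing_diff_left: "pairing d (u - v) F = pairing d u F - pairing d v F"
  and pairing_bscale_left: "pairing d (bscale c v) F = c * pairing d v F"
  by (simp_all add: pairing_def ring_distribs sum.distrib sum_subtractf sum_distrib_left mult_ac)

lemma pairing_sum_left: "pairing d (\<Sum>x\<in>A. f x) F = (\<Sum>x\<in>A. pairing d (f x) F)"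
  by (induction A rule: infinite_finite_induct) (simp_all add: pairing_add_left)

lemmas pairing_left = pairing_add_left pairing_diff_left pairing_bscale_left pairing_sum_left

lemma pairing_0_right [simp]: "pairing d F 0 = 0"
  and pairing_right: "pairing d F (u + v) = pairing d F u + pairing d F v"
    "pairing d F (u - v) = pairing d F u - pairing d F v"
    "pairing d F (bscale c v) = c * pairing d F v"
    "pairing d F (\<Sum>x\<in>A. f x) = (\<Sum>x\<in>A. pairing d F (f x))"
  by (simp_all add: pairing_commute[of d F] pairing_left)

lemma pairing_bmonom:
  assumes "F \<in> bforms d"
  shows "pairing d (bmonom i j) F = fact i * fact j * bcoeff F i j"
proof -
  have "pairing d (bmonom i j) F
      = (\<Sum>k\<le>d. if k = i then (if j = d - i then fact i * fact j * bcoeff F i j else 0) else 0)"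
    unfolding pairing_def by (intro sum.cong) (auto simp: bcoeff_bmonom)
  also have "\<dots> = fact i * fact j * bcoeff F i j"
    using assms by (auto simp: sum.delta bformsD)
  finally show ?thesis .
qed

lemma pairing_eq_0_if_degree_neq: "v \<in> bforms m \<Longrightarrow> m \<noteq> d \<Longrightarrow> pairing d v F = 0"
  unfolding pairing_def by (intro sum.neutral) (auto simp: bformsD)

lemma pairing_nondegenerate:
  assumes "F \<in> bforms d" "\<And>v. v \<in> bforms d \<Longrightarrow> pairing d v F = 0"
  shows "F = 0"
proof (rule bpoly_eqI)
  fix i j
  show "bcoeff F i j = bcoeff 0 i j"
  proof (cases "i + j = d")
    case True
    then show ?thesis
      using assms(2)[of "bmonom i j"] pairing_bmonom[OF assms(1), of i j] bmonom_in_bforms[OF True]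
      by simp
  qed (use assms in \<open>simp add: bformsD\<close>)
qed

text \<open>The value of \<open>\<phi>\<close> on a monomial fixes a coefficient of \<open>G\<close>
  up to a factorial weight, invertible in characteristic zero. Linearity is asked only in degree
  \<open>d\<close>, because coordinates in a basis are linear only on its span.\<close>

lemma pairing_represents:
  fixes \<phi> :: "'k::field_char_0 poly poly \<Rightarrow> 'k"
  assumes add: "\<And>u v. u \<in> bforms d \<Longrightarrow> v \<in> bforms d \<Longrightarrow> \<phi> (u + v) = \<phi> u + \<phi> v"
    and scale: "\<And>c v. v \<in> bforms d \<Longrightarrow> \<phi> (bscale c v) = c * \<phi> v"
  obtains G where "G \<in> bforms d" "\<And>v. v \<in> bforms d \<Longrightarrow> pairing d v G = \<phi> v"
proof
  let ?m = "\<lambda>i. bmonom i (d - i) :: 'k poly poly"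
  define G where "G = (\<Sum>i\<le>d. bscale (\<phi> (?m i) / (fact i * fact (d - i))) (?m i))"
  have m: "?m i \<in> bforms d" if "i \<le> d" for i
    using that by (intro bmonom_in_bforms) simp
  show G: "G \<in> bforms d"
    unfolding G_def using m
    by (intro bp.subspace_sum[OF subspace_bforms] bp.subspace_scale[OF subspace_bforms]) auto
  have bcoeff_G: "bcoeff G i (d - i) = \<phi> (?m i) / (fact i * fact (d - i))" if "i \<le> d" for i
  proof -
    have "bcoeff G i (d - i) = (\<Sum>k\<le>d. if k = i then \<phi> (?m i) / (fact i * fact (d - i)) else 0)"
      unfolding G_def coeff_sum bcoeff_bscale by (intro sum.cong refl) (auto simp: bcoeff_bmonom)
    then show ?thesis
      using that by simp
  qed
  have \<phi>_sum: "\<phi> (\<Sum>x\<in>A. f x) = (\<Sum>x\<in>A. \<phi> (f x))" if "finite A" "\<And>x. x \<in> A \<Longrightarrow> f x \<in> bforms d"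
    for A :: "nat set" and f
    using that
  proof (induction A rule: finite_induct)
    case empty
    show ?case
      using scale[OF bp.subspace_0[OF subspace_bforms], of 0] by simp
  next
    case (insert x A)
    then show ?case
      using add[of "f x" "sum f A"] bp.subspace_sum[OF subspace_bforms, of A f] by simp
  qed
  fix v :: "'k poly poly" assume v: "v \<in> bforms d"
  have "pairing d v G = (\<Sum>i\<le>d. bcoeff v i (d - i) * \<phi> (?m i))"
    unfolding pairing_def by (intro sum.cong refl) (simp add: bcoeff_G)
  also have "\<dots> = (\<Sum>i\<le>d. \<phi> (bscale (bcoeff v i (d - i)) (?m i)))"
    using m by (intro sum.cong refl) (simp add: scale)
  also have "\<dots> = \<phi> (\<Sum>i\<le>d. bscale (bcoeff v i (d - i)) (?m i))"
    using m by (intro \<phi>_sum[symmetric]) (auto intro: bp.subspace_scale[OF subspace_bforms])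
  finally show "pairing d v G = \<phi> v"
    using bforms_expansion[OF v] by simp
qed

text \<open>As \<open>R\<close> and \<open>S\<close> share one type and the pairing is symmetric,
  this serves for complements in both directions.\<close>

definition perp :: "nat \<Rightarrow> 'k::field_char_0 poly poly set \<Rightarrow> 'k poly poly set"
  where "perp d W = {F \<in> bforms d. \<forall>w\<in>W. pairing d w F = 0}"

lemma subspace_perp: "bp.subspace (perp d W)"
  using subspace_bforms[of d] by (auto simp: bp.subspace_def perp_def pairing_right)

text \<open>A basis \<open>C\<close> of \<open>W\<close> is extended by \<open>D\<close> to a basis
  of all forms of degree \<open>d\<close>. The forms representing the coordinates at elements of
  \<open>D\<close> kill \<open>W\<close>, and they are the basis of the complement dual to
  \<open>D\<close>.\<close>

lemma dual_basis:
  assumes W: "bp.subspace W" "W \<subseteq> bforms d"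
  obtains D G where "finite D" "D \<subseteq> bforms d" "card D + bp.dim W = d + 1"
    "\<forall>b\<in>D. G b \<in> perp d W"
    "\<forall>v\<in>bforms d. v - (\<Sum>b\<in>D. bscale (pairing d v (G b)) b) \<in> W"
    "bp.dim (perp d W) = card D"
proof -
  obtain C where C: "C \<subseteq> W" "bp.independent C" "W \<subseteq> bp.span C" "card C = bp.dim W"
    using bp.basis_exists[of W] by metis
  obtain B where B: "C \<subseteq> B" "B \<subseteq> bforms d" "bp.independent B" "bforms d \<subseteq> bp.span B"
    using bp.maximal_independent_subset_extend[OF subset_trans[OF C(1) W(2)] C(2)] .
  have finB: "finite B"
    using bp.independent_span_bound[OF finite_bmonoms B(3)] B(2) bforms_subset_span by blast
  \<comment> \<open>\<open>G b\<close> represents the functional that reads off the coordinate at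
    \<open>b\<close>.\<close>
  have "\<exists>G. G \<in> bforms d \<and> (\<forall>v\<in>bforms d. pairing d v G = bp.representation B v b)" for b
  proof -
    have B': "v \<in> bp.span B" if "v \<in> bforms d" for v
      using that B by blast
    obtain G where "G \<in> bforms d" "\<And>v. v \<in> bforms d \<Longrightarrow> pairing d v G = bp.representation B v b"
      by (rule pairing_represents[of d "\<lambda>v. bp.representation B v b"])
        (simp_all add: B' bp.representation_add[OF B(3)] bp.representation_scale[OF B(3)])
    then show ?thesis
      by blast
  qed
  then obtain G where G: "\<And>b. G b \<in> bforms d"
    "\<And>b v. v \<in> bforms d \<Longrightarrow> pairing d v (G b) = bp.representation B v b"
    by metis
  define D where "D = B - C"
  have D: "finite D" "D \<subseteq> bforms d" "D \<inter> C = {}" "D \<union> C = B"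
    using B finB by (auto simp: D_def)
  have finC: "finite C"
    using B finB by (auto intro: finite_subset)
  have "card B = d + 1"
    using bp.basis_card_eq_dim[OF B(2,4,3)] by (simp add: dim_bforms)
  then have card: "card D + bp.dim W = d + 1"
    using card_Un_disjoint[OF D(1) finC D(3)] D(4) C(4) by simp
  have perp: "G b \<in> perp d W" if b: "b \<in> D" for b
  proof -
    have "pairing d w (G b) = 0" if w: "w \<in> W" for w
    proof -
      have "bp.representation B w = bp.representation C w"
        using w C B by (intro bp.representation_extend) auto
      then show ?thesis
        using G(2)[OF subsetD[OF W(2) w], of b] b bp.representation_ne_zero[of C w b] by (auto simp: D_def)
    qed
    then show ?thesis
      using G by (simp add: perp_def)
  qed
  have rest: "v - (\<Sum>b\<in>D. bscale (pairing d v (G b)) b) \<in> W" if v: "v \<in> bforms d" for v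
  proof -
    have "(\<Sum>b\<in>B. bscale (pairing d v (G b)) b) = v"
      unfolding G(2)[OF v] using v B finB by (intro bp.sum_representation_eq) auto
    then have "v - (\<Sum>b\<in>D. bscale (pairing d v (G b)) b) = (\<Sum>b\<in>C. bscale (pairing d v (G b)) b)"
      using sum.union_disjoint[OF D(1) finC D(3), of "\<lambda>b. bscale (pairing d v (G b)) b"] D(4)
      by (simp add: algebra_simps)
    also have "\<dots> \<in> W"
      using C(1) by (intro bp.subspace_sum[OF W(1)] bp.subspace_scale[OF W(1)]) auto
    finally show ?thesis .
  qed
  have delta: "pairing d b (G b') = (if b' = b then 1 else 0)" if "b \<in> D" for b b'
    using that D G(2)[of b b'] bp.representation_basis[OF B(3), of b] by auto
  \<comment> \<open>By nondegeneracy: subtracting from \<open>v\<close> its \<open>D\<close>-part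
    leaves an element of \<open>W\<close>, to which \<open>F\<close> is orthogonal.\<close>
  have F_eq: "F = (\<Sum>b\<in>D. bscale (pairing d b F) (G b))" if F: "F \<in> perp d W" for F
  proof -
    let ?F' = "(\<Sum>b\<in>D. bscale (pairing d b F) (G b))"
    have "F - ?F' = 0"
    proof (rule pairing_nondegenerate)
      show "F - ?F' \<in> bforms d"
        using F G unfolding perp_def
        by (intro bp.subspace_diff[OF subspace_bforms] bp.subspace_sum[OF subspace_bforms]
            bp.subspace_scale[OF subspace_bforms]) auto
      fix v :: "'a poly poly" assume v: "v \<in> bforms d"
      have "pairing d (v - (\<Sum>b\<in>D. bscale (pairing d v (G b)) b)) F = 0"
        using rest[OF v] F by (simp add: perp_def)
      then show "pairing d v (F - ?F') = 0"
        by (simp add: pairing_left pairing_right mult.commute)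
    qed
    then show ?thesis
      by simp
  qed
  have inj: "inj_on G D"
  proof (rule inj_onI, rule ccontr)
    fix x y assume "x \<in> D" "y \<in> D" "G x = G y" "x \<noteq> y"
    then show False
      using delta[of x x] delta[of x y] by simp
  qed
  have "bp.dim (perp d W) = card D"
  proof (rule bp.dim_unique)
    show "G ` D \<subseteq> perp d W"
      using perp by auto
    show "perp d W \<subseteq> bp.span (G ` D)"
    proof
      fix F assume "F \<in> perp d W"
      then show "F \<in> bp.span (G ` D)"
        by (subst F_eq, assumption) (intro bp.span_sum bp.span_scale bp.span_base imageI)
    qed
    show "bp.independent (G ` D)"
    proof (rule bp.independent_if_scalars_zero)
      fix c x assume sum: "(\<Sum>x\<in>G ` D. bscale (c x) x) = 0" and "x \<in> G ` D"
      then obtain b where b: "b \<in> D" "x = G b"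
        by auto
      have "0 = pairing d b (\<Sum>b\<in>D. bscale (c (G b)) (G b))"
        using sum inj by (simp add: sum.reindex)
      also have "\<dots> = (\<Sum>b'\<in>D. if b' = b then c (G b) else 0)"
        unfolding pairing_right using b by (intro sum.cong) (auto simp: delta)
      also have "\<dots> = c (G b)"
        using b D by simp
      finally show "c x = 0"
        using b by simp
    qed (use D in simp)
    show "card (G ` D) = card D"
      using inj by (rule card_image)
  qed
  with D(1,2) card perp rest show ?thesis
    by (intro that[of D G] ballI)
qed

lemma dim_perp:
  assumes W: "bp.subspace W" "W \<subseteq> bforms d"
  shows "bp.dim (perp d W) + bp.dim W = d + 1"
proof -
  obtain D G where "finite D" "D \<subseteq> bforms d" and card: "card D + bp.dim W = d + 1"
    and "\<forall>b\<in>D. G b \<in> perp d W"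
    "\<forall>v\<in>bforms d. v - (\<Sum>b\<in>D. bscale (pairing d v (G b)) b) \<in> W"
    and dim: "bp.dim (perp d W) = card D"
    using dual_basis[OF W] .
  show ?thesis
    using card dim by simp
qed

text \<open>The coordinates of \<open>F\<close> on \<open>D\<close> are its pairings with the
  \<open>G b\<close>, which lie in the complement; they vanish, so only the part in \<open>W\<close>
  remains.\<close>

lemma perp_perp:
  assumes W: "bp.subspace W" "W \<subseteq> bforms d"
    and F: "F \<in> bforms d" "\<And>G. G \<in> perp d W \<Longrightarrow> pairing d G F = 0"
  shows "F \<in> W"
proof -
  obtain D G where "finite D" "D \<subseteq> bforms d" "card D + bp.dim W = d + 1"
    and G: "\<forall>b\<in>D. G b \<in> perp d W"
    "\<forall>v\<in>bforms d. v - (\<Sum>b\<in>D. bscale (pairing d v (G b)) b) \<in> W"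
    and "bp.dim (perp d W) = card D"
    using dual_basis[OF W] .
  have "pairing d F (G b) = 0" if "b \<in> D" for b
    using F(2)[of "G b"] G(1) that by (simp add: pairing_commute)
  then show ?thesis
    using G(2) F(1) by fastforce
qed

section \<open>Differentiation expressed through the pairing\<close>

lemma bcoeff_higher_pderivs:
  "bcoeff ((map_poly pderiv ^^ a) ((pderiv ^^ b) F)) i j
     = pochhammer (of_nat (Suc i)) a * (pochhammer (of_nat (Suc j)) b * bcoeff F (a + i) (b + j))"
proof -
  have "coeff ((map_poly pderiv ^^ a) G) j = (pderiv ^^ a) (coeff G j)" for G :: "'a poly poly" and j
    by (induction a) (simp_all add: coeff_map_poly)
  \<comment> \<open>The outer derivative yields its Pochhammer factor in the polynomial coefficient
    ring; there it is a constant polynomial.\<close>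
  moreover have "pochhammer (of_nat (Suc j)) b = [:pochhammer (of_nat (Suc j)) b :: 'a:]"
    by (simp add: pochhammer_prod prod_to_poly of_nat_poly)
  ultimately show ?thesis
    by (simp only: coeff_higher_pderiv) (simp add: add.commute)
qed

lemma fact_add_pochhammer: "fact (a + i) = fact i * (pochhammer (of_nat (Suc i)) a :: 'a::field_char_0)"
  by (induction a) (simp_all add: pochhammer_Suc algebra_simps)

lemma pairing_mult_expansion:
  "pairing d (u * v) F
     = (\<Sum>b\<le>degree u. \<Sum>a\<le>degree (coeff u b). bcoeff u a b * pairing d (bmonom a b * v) F)"
  by (subst (1) sum_bscale_bmonom[symmetric, of u])
    (simp add: sum_distrib_right pairing_left bscale_mult_left)

text \<open>The coefficient of u.F at exponents i, j, times i! j!, is the pairing of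
  \<open>u * bmonom i j\<close> with \<open>F\<close>. So u.F vanishes exactly when all multiples of
  \<open>u\<close> pair to 0 with \<open>F\<close>.\<close>

lemma bact_eq_0_iff:
  assumes F: "F \<in> bforms d"
  shows "bact u F = 0 \<longleftrightarrow> (\<forall>v. pairing d (u * v) F = 0)"
proof -
  have coeff: "fact i * fact j * bcoeff (bact u F) i j = pairing d (u * bmonom i j) F" for i j
    unfolding pairing_mult_expansion[of d u] bact_def bmonom_mult pairing_bmonom[OF F]
    by (simp add: coeff_sum bcoeff_higher_pderivs fact_add_pochhammer sum_distrib_left mult_ac)
  show ?thesis
  proof
    assume 0: "bact u F = 0"
    show "\<forall>v. pairing d (u * v) F = 0"
    proof
      fix v
      have "pairing d (bmonom a b * u) F = 0" for a b
        using coeff[of a b] 0 by (simp add: mult.commute)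
      then show "pairing d (u * v) F = 0"
        using pairing_mult_expansion[of d v u F] by (simp add: mult.commute)
    qed
  next
    assume "\<forall>v. pairing d (u * v) F = 0"
    then show "bact u F = 0"
      using coeff by (intro bpoly_eqI) (simp del: of_nat_Suc)
  qed
qed

lemma ann_eq: "\<Lambda> \<subseteq> bforms d \<Longrightarrow> ann \<Lambda> = {u. \<forall>F\<in>\<Lambda>. \<forall>v. pairing d (u * v) F = 0}"
  unfolding ann_def using bact_eq_0_iff by blast

section \<open>Restriction to the rational normal curve\<close>

definition beval :: "'k::field poly poly \<Rightarrow> 'k \<Rightarrow> 'k \<Rightarrow> 'k"
  where "beval p a b = poly (poly p [:b:]) a"

lemma beval_simps [simp]:
  "beval 0 a b = 0" "beval (p + q) a b = beval p a b + beval q a b"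
  "beval (p - q) a b = beval p a b - beval q a b" "beval (p * q) a b = beval p a b * beval q a b"
  "beval (bscale c p) a b = c * beval p a b" "beval (p ^ n) a b = beval p a b ^ n"
  by (simp_all add: beval_def bscale_def)

lemma beval_bmonom [simp]: "beval (bmonom i j) a b = a ^ i * b ^ j"
  by (simp add: beval_def bmonom_def poly_monom mult.commute flip: poly_const_pow)

lemma beval_sum [simp]: "beval (\<Sum>x\<in>A. f x) a b = (\<Sum>x\<in>A. beval (f x) a b)"
  by (induction A rule: infinite_finite_induct) simp_all

lemma beval_prod [simp]: "beval (\<Prod>x\<in>A. f x) a b = (\<Prod>x\<in>A. beval (f x) a b)"
  by (induction A rule: infinite_finite_induct) (simp_all add: beval_def)

text \<open>For each nonzero \<open>b\<close> the specialised polynomial vanishes identically, so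
  \<open>p\<close> would have infinitely many constant roots \<open>[:b:]\<close>. The restriction
  to \<open>b \<noteq> 0\<close> matches \<open>vanishing_forms_curve\<close>, where it keeps the
  linear form nonzero.\<close>

lemma beval_eq_0_imp:
  fixes p :: "'k::field_char_0 poly poly"
  assumes "\<And>a b. b \<noteq> 0 \<Longrightarrow> beval p a b = 0"
  shows "p = 0"
proof (rule ccontr)
  assume "p \<noteq> 0"
  have "poly p [:b:] = 0" if "b \<noteq> 0" for b
    using assms[OF that] poly_all_0_iff_0[of "poly p [:b:]"] by (simp add: beval_def)
  then have "(\<lambda>b. [:b:]) ` (- {0}) \<subseteq> {x. poly p x = 0}"
    by auto
  moreover have "finite {x. poly p x = 0}"
    using \<open>p \<noteq> 0\<close> by (rule poly_roots_finite)
  ultimately have "finite ((\<lambda>b :: 'k. [:b:]) ` (- {0}))"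
    by (rule finite_subset)
  then have "finite (- {0 :: 'k})"
    by (rule finite_imageD) (simp add: inj_on_def)
  then show False
    using infinite_UNIV_char_0[where 'a = 'k] by (simp add: Compl_eq_Diff_UNIV)
qed

definition lform :: "'k::field \<Rightarrow> 'k \<Rightarrow> 'k poly poly"
  where "lform a b = bscale a (bmonom 1 0) + bscale b (bmonom 0 1)"

lemma lform_in_bforms: "lform a b \<in> bforms 1"
  unfolding lform_def
  by (intro bp.subspace_add[OF subspace_bforms] bp.subspace_scale[OF subspace_bforms] bmonom_in_bforms)
    simp_all

lemma bmonom_power: "bmonom i j ^ n = bmonom (i * n) (j * n)"
  by (induction n) (simp_all add: bmonom_0 bmonom_mult)

lemma bscale_power: "bscale c F ^ n = bscale (c ^ n) (F ^ n)"
  by (simp add: bscale_def smult_power flip: poly_const_pow)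

lemma bcoeff_lform_power:
  assumes "i \<le> d"
  shows "bcoeff (lform a b ^ d) i (d - i) = of_nat (d choose i) * a ^ i * b ^ (d - i)"
proof -
  have "lform a b ^ d = (\<Sum>k\<le>d. of_nat (d choose k) * bscale (a ^ k * b ^ (d - k)) (bmonom k (d - k)))"
    unfolding lform_def binomial_ring
    by (intro sum.cong refl)
      (simp add: bscale_power bmonom_power bscale_mult_left bscale_mult_right bmonom_mult mult.assoc)
  also have "\<dots> = (\<Sum>k\<le>d. bscale (of_nat (d choose k) * a ^ k * b ^ (d - k)) (bmonom k (d - k)))"
    by (intro sum.cong refl) (simp add: bscale_def of_nat_poly mult.assoc)
  finally have eq: "lform a b ^ d = \<dots>" .
  have "bcoeff (lform a b ^ d) i (d - i)
      = (\<Sum>k\<le>d. if k = i then of_nat (d choose i) * a ^ i * b ^ (d - i) else 0)"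
    unfolding eq coeff_sum bcoeff_bscale by (intro sum.cong refl) (auto simp: bcoeff_bmonom)
  then show ?thesis
    using assms by simp
qed

lemma dvd_mult_diff:
  fixes u :: "'a::comm_ring_1"
  assumes "u dvd a - a'" "u dvd b - b'"
  shows "u dvd a * b - a' * b'"
proof -
  have "a * b - a' * b' = (a - a') * b + a' * (b - b')"
    by (simp add: algebra_simps)
  then show ?thesis
    using assms by simp
qed

lemma dvd_power_diff: "u dvd a - a' \<Longrightarrow> u dvd a ^ n - a' ^ n" for u :: "'a::comm_ring_1"
  by (induction n) (simp_all add: dvd_mult_diff)

lemma dvd_prod_diff:
  fixes u :: "'a::comm_ring_1"
  shows "finite A \<Longrightarrow> (\<And>x. x \<in> A \<Longrightarrow> u dvd f x - g x) \<Longrightarrow> u dvd prod f A - prod g A"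
  by (induction A rule: finite_induct) (simp_all add: dvd_mult_diff)

text \<open>
  Evaluating \<open>f\<close> at points whose coordinates are polynomials in \<open>R\<close>. Since \<^term>\<open>coord_forms\<close>
  consists of functions, the values are only characterised pointwise.
\<close>

lemma coord_forms_lift:
  fixes w w' :: "nat \<Rightarrow> 'k::field poly poly"
  assumes f: "f \<in> coord_forms d n"
    and w: "\<And>i. i \<le> d \<Longrightarrow> w i \<in> bforms d" "\<And>i. i \<le> d \<Longrightarrow> u dvd w i - w' i"
  shows "\<exists>p p'. p \<in> bforms (d * n) \<and> u dvd p - p' \<and>
    (\<forall>a b F. (\<forall>i\<le>d. bcoeff F i (d - i) = beval (w i) a b) \<longrightarrow> f F = beval p a b) \<and>
    (\<forall>a b F. (\<forall>i\<le>d. bcoeff F i (d - i) = beval (w' i) a b) \<longrightarrow> f F = beval p' a b)"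
  using f unfolding coord_forms_def
proof (induction rule: fn.span_induct_alt)
  case base
  show ?case
    by (intro exI[of _ 0]) (simp add: bp.subspace_0[OF subspace_bforms])
next
  case (step c g f)
  from step(1) obtain m where m: "(\<Sum>i\<le>d. m i) = n"
    "g = (\<lambda>F. \<Prod>i\<le>d. bcoeff F i (d - i) ^ m i)"
    by auto
  from step(2) obtain p p' where p: "p \<in> bforms (d * n)" "u dvd p - p'"
    "\<And>a b F. \<forall>i\<le>d. bcoeff F i (d - i) = beval (w i) a b \<Longrightarrow> f F = beval p a b"
    "\<And>a b F. \<forall>i\<le>d. bcoeff F i (d - i) = beval (w' i) a b \<Longrightarrow> f F = beval p' a b"
    by blast
  define r where "r = (\<Prod>i\<le>d. w i ^ m i)"
  define r' where "r' = (\<Prod>i\<le>d. w' i ^ m i)"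
  have "r \<in> bforms (\<Sum>i\<le>d. d * m i)"
    unfolding r_def using w(1) by (intro prod_in_bforms power_in_bforms) auto
  then have r: "r \<in> bforms (d * n)"
    using m(1) by (simp flip: sum_distrib_left)
  have "u dvd r - r'"
    unfolding r_def r'_def using w(2) by (intro dvd_prod_diff dvd_power_diff) auto
  then have "u dvd bscale c (r - r') + (p - p')"
    using p(2) by (simp add: bscale_def dvd_smult)
  also have "bscale c (r - r') + (p - p') = (bscale c r + p) - (bscale c r' + p')"
    by (simp add: bscale_def smult_diff_right)
  finally have dvd: "u dvd (bscale c r + p) - (bscale c r' + p')" .
  have "bscale c r + p \<in> bforms (d * n)"
    using r p(1) by (intro bp.subspace_add[OF subspace_bforms] bp.subspace_scale[OF subspace_bforms])
  with dvd show ?case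
    using p(3,4)
    by (intro exI[of _ "bscale c r + p"] exI[of _ "bscale c r' + p'"])
      (simp add: m(2) fscale_def r_def r'_def)
qed

section \<open>Forms of degree n on projective space and their restriction to the curve\<close>

lemma subspace_coord_forms: "fn.subspace (coord_forms d n)"
  unfolding coord_forms_def by (rule fn.subspace_span)

text \<open>Exponents at indices beyond \<open>d\<close> are unconstrained but do not affect the
  function; setting them to 0 leaves finitely many monomials.\<close>

lemma coord_forms_finite_span:
  obtains B where "finite B" "coord_forms d n \<subseteq> fn.span B"
proof
  let ?g = "\<lambda>m F. \<Prod>i\<le>d. bcoeff F i (d - i) ^ m i"
  let ?M = "{m. \<forall>i. (i \<in> {..d} \<longrightarrow> m i \<in> {..n}) \<and> (i \<notin> {..d} \<longrightarrow> m i = 0)} :: (nat \<Rightarrow> nat) set"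
  have "finite ?M"
    by (rule finite_set_of_finite_funs) simp_all
  then show "finite (?g ` ?M)"
    by simp
  have "?g m \<in> ?g ` ?M" if "(\<Sum>i\<le>d. m i) = n" for m
  proof (rule image_eqI)
    show "?g m = ?g (\<lambda>i. if i \<le> d then m i else 0)"
      by (intro ext prod.cong) auto
    show "(\<lambda>i. if i \<le> d then m i else 0) \<in> ?M"
      using that member_le_sum[of _ "{..d}" m] by auto
  qed
  then show "coord_forms d n \<subseteq> fn.span (?g ` ?M)"
    unfolding coord_forms_def by (intro fn.span_mono subsetI) (elim CollectE exE conjE, simp only:)
qed

text \<open>Every \<open>s\<close> up to \<open>d * n\<close> is a sum of \<open>n\<close> numbers
  from 0 to \<open>d\<close>, where \<open>m i\<close> counts the summands equal to
  \<open>i\<close>. This finds a coordinate monomial with prescribed restriction to the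
  curve.\<close>

lemma exists_exponents:
  "s \<le> d * n \<Longrightarrow> \<exists>m. (\<Sum>i\<le>d. m i) = n \<and> (\<Sum>i\<le>d. i * m i) = s" for d n s :: nat
proof (induction n arbitrary: s)
  case 0
  then show ?case
    by (intro exI[of _ "\<lambda>_. 0"]) simp
next
  case (Suc n)
  \<comment> \<open>Greedy choice: the new summand is as large as possible, so the remainder is at
    most \<open>d * n\<close>.\<close>
  define k where "k = min s d"
  have "s - k \<le> d * n"
    using Suc.prems by (auto simp: k_def min_def)
  then obtain m where m: "(\<Sum>i\<le>d. m i) = n" "(\<Sum>i\<le>d. i * m i) = s - k"
    using Suc.IH by blast
  let ?m = "\<lambda>i. m i + (if i = k then 1 else 0)"
  have "(\<Sum>i\<le>d. ?m i) = Suc n"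
    using m(1) by (simp add: sum.distrib k_def)
  moreover have "(\<Sum>i\<le>d. i * ?m i) = (\<Sum>i\<le>d. i * m i) + (\<Sum>i\<le>d. if i = k then k else 0)"
    unfolding sum.distrib[symmetric] by (intro sum.cong) auto
  then have "(\<Sum>i\<le>d. i * ?m i) = s"
    using m(2) by (simp add: k_def)
  ultimately show ?case
    by blast
qed

text \<open>Projective normality of the rational normal curve. A coordinate monomial restricts to a
  monomial in \<open>a\<close> and \<open>b\<close> times a product of binomial coefficients, which
  is invertible in characteristic zero.\<close>

lemma coord_forms_restrict_surj:
  fixes r :: "'k::field_char_0 poly poly"
  assumes "r \<in> bforms (d * n)"
  obtains f where "f \<in> coord_forms d n" "\<And>a b. f (lform a b ^ d) = beval r a b"
proof -
  have mon: "\<exists>f \<in> coord_forms d n. \<forall>a b :: 'k. f (lform a b ^ d) = a ^ s * b ^ (d * n - s)"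
    if s: "s \<le> d * n" for s
  proof -
    obtain m where m: "(\<Sum>i\<le>d. m i) = n" "(\<Sum>i\<le>d. i * m i) = s"
      using exists_exponents[OF s] by blast
    let ?g = "\<lambda>F :: 'k poly poly. \<Prod>i\<le>d. bcoeff F i (d - i) ^ m i"
    define K :: 'k where "K = (\<Prod>i\<le>d. of_nat (d choose i) ^ m i)"
    have K: "K \<noteq> 0"
      by (simp add: K_def)
    \<comment> \<open>The exponents of \<open>a\<close> and \<open>b\<close> add up to
      \<open>d * n\<close>, which identifies the exponent of \<open>b\<close>.\<close>
    have "(\<Sum>i\<le>d. (d - i) * m i) + (\<Sum>i\<le>d. i * m i) = (\<Sum>i\<le>d. d * m i)"
      unfolding sum.distrib[symmetric] add_mult_distrib[symmetric] by (intro sum.cong) auto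
    then have m': "(\<Sum>i\<le>d. (d - i) * m i) = d * n - s"
      using m by (simp flip: sum_distrib_left)
    have "?g (lform a b ^ d) = K * (a ^ s * b ^ (d * n - s))" for a b
    proof -
      have "?g (lform a b ^ d) = (\<Prod>i\<le>d. of_nat (d choose i) ^ m i * a ^ (i * m i) * b ^ ((d - i) * m i))"
        by (intro prod.cong) (auto simp: bcoeff_lform_power power_mult_distrib power_mult)
      also have "\<dots> = K * a ^ (\<Sum>i\<le>d. i * m i) * b ^ (\<Sum>i\<le>d. (d - i) * m i)"
        by (simp only: prod.distrib K_def power_sum)
      finally show ?thesis
        by (simp only: m m' mult.assoc)
    qed
    moreover have "?g \<in> coord_forms d n"
      unfolding coord_forms_def using m(1) by (intro fn.span_base) blast
    ultimately show ?thesis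
      using K by (intro bexI[of _ "fscale (inverse K) ?g"] fn.subspace_scale[OF subspace_coord_forms])
        (auto simp: fscale_def)
  qed
  then have "\<exists>g. \<forall>s\<in>{..d * n}. g s \<in> coord_forms d n
      \<and> (\<forall>a b :: 'k. g s (lform a b ^ d) = a ^ s * b ^ (d * n - s))"
    using mon unfolding Bex_def by (intro bchoice ballI) simp
  then obtain g where "\<forall>s\<in>{..d * n}. g s \<in> coord_forms d n
      \<and> (\<forall>a b :: 'k. g s (lform a b ^ d) = a ^ s * b ^ (d * n - s))" ..
  then have g: "\<And>s. s \<le> d * n \<Longrightarrow> g s \<in> coord_forms d n"
    "\<And>s a b. s \<le> d * n \<Longrightarrow> g s (lform a b ^ d) = a ^ s * b ^ (d * n - s)"
    by auto
  have sum: "(\<Sum>s\<in>A. fscale (c s) (g s)) F = (\<Sum>s\<in>A. c s * g s F)" for A c F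
    by (induction A rule: infinite_finite_induct) (simp_all add: fscale_def)
  show ?thesis
  proof
    show "(\<Sum>s\<le>d * n. fscale (bcoeff r s (d * n - s)) (g s)) \<in> coord_forms d n"
      using g(1) by (intro fn.subspace_sum[OF subspace_coord_forms] fn.subspace_scale[OF subspace_coord_forms]) auto
    show "(\<Sum>s\<le>d * n. fscale (bcoeff r s (d * n - s)) (g s)) (lform a b ^ d) = beval r a b" for a b
      using arg_cong[OF bforms_expansion[OF assms], of "\<lambda>p. beval p a b"] by (simp add: sum g(2))
  qed
qed

section \<open>Secant planes\<close>

lemma line_in_PP_iff:
  assumes "bp.subspace V" "F \<noteq> 0"
  shows "line F \<in> PP V \<longleftrightarrow> F \<in> V"
proof
  assume "line F \<in> PP V"
  then obtain G where G: "G \<in> V" "line F = line G"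
    by (auto simp: PP_def)
  have "F \<in> line F"
    by (simp add: line_def bp.span_base)
  then have "F \<in> bp.span {G}"
    using G by (simp add: line_def)
  then show "F \<in> V"
    using bp.span_minimal[of "{G}" V] G assms by blast
qed (use assms in \<open>auto simp: PP_def\<close>)

text \<open>The \<open>V i\<close> may exhibit a common line through different generators, but as
  subspaces they all contain any one generator of it.\<close>

lemma PP_Inter:
  assumes "I \<noteq> {}" "\<And>i. i \<in> I \<Longrightarrow> bp.subspace (V i)"
  shows "PP (\<Inter>i\<in>I. V i) = (\<Inter>i\<in>I. PP (V i))"
proof (intro subset_antisym subsetI)
  fix l assume l: "l \<in> (\<Inter>i\<in>I. PP (V i))"
  then obtain F where F: "l = line F" "F \<noteq> 0"
    using assms(1) by (auto simp: PP_def)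
  then have "F \<in> (\<Inter>i\<in>I. V i)"
    using l line_in_PP_iff[OF assms(2) F(2)] by auto
  then show "l \<in> PP (\<Inter>i\<in>I. V i)"
    using F by (auto simp: PP_def)
qed (auto simp: PP_def)

text \<open>The zero vector is covered since it lies on the line through any nonzero vector of
  \<open>V\<close>; one exists because the dimension is nonzero.\<close>

lemma vanishing_forms_eq_0:
  assumes f: "f \<in> vanishing_forms d (PP V) n" and V: "bp.dim V \<noteq> 0" and F: "F \<in> V"
  shows "f F = 0"
proof -
  have van: "f G = 0" if "G \<in> line F'" "F' \<in> V" "F' \<noteq> 0" for G F'
    using f that unfolding vanishing_forms_def PP_def by blast
  show ?thesis
  proof (cases "F = 0")
    case False
    then show ?thesis
      using van[of F F] F by (simp add: line_def bp.span_base)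
  next
    case True
    have "\<not> V \<subseteq> {0}"
    proof
      assume "V \<subseteq> {0}"
      then have "bp.dim V \<le> card ({} :: 'a poly poly set)"
        by (intro bp.dim_le_card) auto
      then show False
        using V by simp
    qed
    then obtain F' where "F' \<in> V" "F' \<noteq> 0"
      by auto
    then show ?thesis
      using van[of 0 F'] True by (simp add: line_def bp.span_zero)
  qed
qed

text \<open>The generic point of the curve, with coordinates \<open>w i\<close>, is congruent modulo
  \<open>u\<close> to a point with coordinates \<open>w' i\<close> whose specialisations lie in the
  complement. There \<open>f\<close> vanishes, so its value at the generic point is divisible by
  \<open>u\<close>.\<close>

lemma vanishing_forms_perp_multiples:
  assumes f: "f \<in> vanishing_forms d (PP (perp d (multiples d u))) n"
    and dim: "bp.dim (perp d (multiples d u)) \<noteq> 0"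
  shows "\<exists>p. u dvd p \<and> (\<forall>a b. f (lform a b ^ d) = beval p a b)"
proof -
  let ?P = "perp d (multiples d u)"
  have "multiples d u \<subseteq> bforms d"
    by (auto simp: multiples_def)
  note dual = dual_basis[OF subspace_multiples this]
  obtain D G where "finite D" and D: "D \<subseteq> bforms d" and "card D + bp.dim (multiples d u) = d + 1"
    and G: "\<forall>b\<in>D. G b \<in> ?P"
    "\<forall>v\<in>bforms d. v - (\<Sum>b\<in>D. bscale (pairing d v (G b)) b) \<in> multiples d u"
    and "bp.dim ?P = card D"
    using dual .
  \<comment> \<open>The coordinates of \<open>lform a b ^ d\<close>, as polynomials in
    \<open>a\<close> and \<open>b\<close>.\<close>
  define w where "w i = bscale (of_nat (d choose i)) (bmonom i (d - i) :: 'a poly poly)" for i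
  define w' where "w' i = (\<Sum>b\<in>D. bscale (pairing d (w i) (G b)) b)" for i
  have w: "w i \<in> bforms d" if "i \<le> d" for i
    unfolding w_def using that by (intro bp.subspace_scale[OF subspace_bforms] bmonom_in_bforms) simp
  have w': "u dvd w i - w' i" if "i \<le> d" for i
    using G(2) w[OF that] unfolding w'_def multiples_def by blast
  have "f \<in> coord_forms d n"
    using f by (simp add: vanishing_forms_def)
  from coord_forms_lift[where w = w and w' = w' and u = u, OF this w w'] obtain p p' where p: "u dvd p - p'"
    "\<And>a b F. \<forall>i\<le>d. bcoeff F i (d - i) = beval (w i) a b \<Longrightarrow> f F = beval p a b"
    "\<And>a b F. \<forall>i\<le>d. bcoeff F i (d - i) = beval (w' i) a b \<Longrightarrow> f F = beval p' a b"
    by blast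
  have "beval p' a b = 0" for a b
  proof -
    \<comment> \<open>the specialization at \<open>(a, b)\<close> of the point with coordinates \<open>w' i\<close>; it lies in \<open>?P\<close>\<close>
    define F where "F = (\<Sum>x\<in>D. bscale (fact d * beval x a b) (G x))"
    have F: "F \<in> ?P"
      unfolding F_def using G(1) by (intro bp.subspace_sum[OF subspace_perp] bp.subspace_scale[OF subspace_perp]) auto
    have "bcoeff F i (d - i) = beval (w' i) a b" if i: "i \<le> d" for i
    proof -
      \<comment> \<open>The binomial coefficient completes the weights of the pairing to d!, whence
        the factor \<open>fact d\<close> in \<open>F\<close>.\<close>
      have "pairing d (w i) (G x) = fact d * bcoeff (G x) i (d - i)" if "x \<in> D" for x
      proof -
        have "G x \<in> bforms d"
          using G(1) that by (auto simp: perp_def)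
        then have "pairing d (w i) (G x) = of_nat (fact i * fact (d - i) * (d choose i)) * bcoeff (G x) i (d - i)"
          by (simp add: w_def pairing_left pairing_bmonom mult_ac)
        then show ?thesis
          using i by (simp only: binomial_fact_lemma of_nat_fact)
      qed
      then show ?thesis
        unfolding F_def w'_def coeff_sum bcoeff_bscale beval_sum beval_simps
        by (intro sum.cong refl) (simp add: mult_ac)
    qed
    then show ?thesis
      using p(3)[of F a b] vanishing_forms_eq_0[OF f dim F] by simp
  qed
  then have "p' = 0"
    by (rule beval_eq_0_imp)
  moreover have "f (lform a b ^ d) = beval p a b" for a b
    by (intro p(2) allI impI) (simp add: bcoeff_lform_power w_def mult.assoc)
  ultimately show ?thesis
    using p(1) by auto
qed

lemma vanishing_forms_curve:
  assumes "f \<in> vanishing_forms d (rational_normal_curve d) n" "b \<noteq> 0"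
  shows "f (lform a b ^ d) = 0"
proof -
  have "bcoeff (lform a b) 0 1 = b"
    by (simp add: lform_def bcoeff_bmonom)
  then have "lform a b \<noteq> 0"
    using assms(2) by auto
  then have "line (lform a b ^ d) \<in> rational_normal_curve d"
    using lform_in_bforms by (auto simp: rational_normal_curve_def)
  then show ?thesis
    using assms(1) by (auto simp: vanishing_forms_def line_def bp.span_base)
qed

lemma subspace_vanishing_forms: "fn.subspace (vanishing_forms d X n)"
  using subspace_coord_forms[of d n] by (auto simp: fn.subspace_def vanishing_forms_def fscale_def)

lemma dim_perp_multiples:
  assumes "u \<in> bforms q" "u \<noteq> 0" "q \<le> d + 1"
  shows "bp.dim (perp d (multiples d u)) = q"
proof -
  have "multiples d u \<subseteq> bforms d"
    by (auto simp: multiples_def)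
  then have "bp.dim (perp d (multiples d u)) + bp.dim (multiples d u) = d + 1"
    by (rule dim_perp[OF subspace_multiples])
  then show ?thesis
    using assms by (simp add: dim_multiples)
qed

text \<open>Modulo multiples of \<open>u\<close>, the forms of degree \<open>d * n\<close> have
  dimension \<open>q\<close>. Lifts of a basis stay independent modulo the two ideals, because
  restriction to the curve sends the ideal of the curve to 0 and that of the plane into the
  multiples of \<open>u\<close>.\<close>

lemma secant_plane_perp_multiples:
  fixes u :: "'k::field_char_0 poly poly"
  assumes u: "u \<in> bforms q" "u \<noteq> 0" and q: "1 \<le> q" "q \<le> d + 1"
  shows "secant_plane d (q - 1) (PP (perp d (multiples d u)))"
proof -
  let ?P = "perp d (multiples d u)"
  let ?X = "rational_normal_curve d :: 'k poly poly set set"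
  have dim: "bp.dim ?P = q"
    using u q(2) by (rule dim_perp_multiples)
  have len: "q \<le> quot_dim fscale (coord_forms d n)
      {f + g |f g. f \<in> vanishing_forms d ?X n \<and> g \<in> vanishing_forms d (PP ?P) n}"
    (is "_ \<le> quot_dim _ _ ?W") if n: "1 \<le> n" for n
  proof -
    obtain D :: "'k poly poly set" where D: "basis_mod bscale (bforms (d * n)) (multiples (d * n) u) D"
      using bp.basis_mod_exists[OF subspace_bforms subspace_multiples] .
    have "bforms (d * n) \<inter> multiples (d * n) u = multiples (d * n) u"
      by (auto simp: multiples_def)
    then have cardD: "finite D" "card D + (d * n + 1 - q) = d * n + 1"
      using bp.basis_mod_card[OF subspace_bforms subspace_multiples finite_bmonoms bforms_subset_span D]
      by (simp_all add: dim_multiples[OF u] dim_bforms)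
    \<comment> \<open>Hence \<open>q \<le> d * n + 1\<close>, so the truncated difference in
      \<open>cardD\<close> is exact.\<close>
    have "d \<le> d * n"
      using n by simp
    then have "card D = q"
      using cardD(2) q(2) by linarith
    have "\<exists>\<phi>. \<forall>r\<in>D. \<phi> r \<in> coord_forms d n \<and> (\<forall>a b. \<phi> r (lform a b ^ d) = beval r a b)"
    proof (intro bchoice ballI)
      fix r assume "r \<in> D"
      then have "r \<in> bforms (d * n)"
        using bp.basis_modD(1)[OF D] by auto
      then show "\<exists>f. f \<in> coord_forms d n \<and> (\<forall>a b. f (lform a b ^ d) = beval r a b)"
        by (rule coord_forms_restrict_surj) auto
    qed
    then obtain \<phi> where "\<forall>r\<in>D. \<phi> r \<in> coord_forms d n \<and> (\<forall>a b. \<phi> r (lform a b ^ d) = beval r a b)" ..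
    then have \<phi>: "\<And>r. r \<in> D \<Longrightarrow> \<phi> r \<in> coord_forms d n"
      "\<And>r a b. r \<in> D \<Longrightarrow> \<phi> r (lform a b ^ d) = beval r a b"
      by auto
    obtain B :: "('k poly poly \<Rightarrow> 'k) set" where B: "finite B" "coord_forms d n \<subseteq> fn.span B"
      using coord_forms_finite_span .
    have "card D \<le> quot_dim fscale (coord_forms d n) ?W"
    proof (rule fn.quot_dim_ge[OF subspace_coord_forms _ B cardD(1)])
      show "fn.subspace ?W"
        by (intro fn.subspace_sums subspace_vanishing_forms)
      show "\<phi> ` D \<subseteq> coord_forms d n"
        using \<phi>(1) by auto
      fix c r assume "(\<Sum>r\<in>D. fscale (c r) (\<phi> r)) \<in> ?W" and r: "r \<in> D"
      then obtain f g where fg: "(\<Sum>r\<in>D. fscale (c r) (\<phi> r)) = f + g"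
        "f \<in> vanishing_forms d ?X n" "g \<in> vanishing_forms d (PP ?P) n"
        by auto
      obtain p where p: "u dvd p" "\<And>a b. g (lform a b ^ d) = beval p a b"
        using vanishing_forms_perp_multiples[OF fg(3)] dim q(1) by auto
      \<comment> \<open>\<open>s\<close> is the restriction to the curve of the given combination of
        lifts.\<close>
      define s where "s = (\<Sum>r\<in>D. bscale (c r) r)"
      have sum: "(\<Sum>r\<in>A. fscale (c r) (\<phi> r)) F = (\<Sum>r\<in>A. c r * \<phi> r F)" for A F
        by (induction A rule: infinite_finite_induct) (simp_all add: fscale_def)
      have "beval (s - p) a b = 0" if b: "b \<noteq> 0" for a b
      proof -
        have "beval s a b = (\<Sum>r\<in>D. c r * \<phi> r (lform a b ^ d))"
          by (simp add: s_def \<phi>(2))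
        also have "\<dots> = (f + g) (lform a b ^ d)"
          unfolding fg(1)[symmetric] sum ..
        finally show ?thesis
          using vanishing_forms_curve[OF fg(2) b] p(2) by simp
      qed
      then have "s - p = 0"
        by (rule beval_eq_0_imp)
      then have "u dvd s"
        using p(1) by simp
      moreover have "s \<in> bforms (d * n)"
        unfolding s_def using bp.basis_modD(1)[OF D]
        by (intro bp.subspace_sum[OF subspace_bforms] bp.subspace_scale[OF subspace_bforms]) auto
      ultimately have "s \<in> multiples (d * n) u"
        by (simp add: multiples_def)
      then show "c r = 0"
        using bp.basis_modD(3)[OF D cardD(1) order_refl _ r, of c] by (simp add: s_def)
    qed
    then show ?thesis
      using \<open>card D = q\<close> by simp
  qed
  \<comment> \<open>The bound holds from degree 1 on, which suffices for the limit inferior.\<close>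
  have "enat q \<le> intersection_length d ?X (PP ?P)"
    unfolding intersection_length_def
    by (rule Liminf_bounded) (use len in \<open>auto simp: eventually_sequentially intro!: exI[of _ 1]\<close>)
  then show ?thesis
    unfolding secant_plane_def using dim q(1) subspace_perp[of d "multiples d u"]
    by (auto simp: perp_def intro!: exI[of _ ?P])
qed

section \<open>Generators of the annihilator\<close>

lemma mem_ann_iff:
  assumes "\<Lambda> \<subseteq> bforms d"
  shows "u \<in> ann \<Lambda> \<longleftrightarrow> (\<forall>F\<in>\<Lambda>. \<forall>a b. pairing d (bmonom a b * u) F = 0)"
proof
  assume "u \<in> ann \<Lambda>"
  then have "pairing d (u * bmonom a b) F = 0" if "F \<in> \<Lambda>" for a b F
    using that by (simp add: ann_eq[OF assms])
  then show "\<forall>F\<in>\<Lambda>. \<forall>a b. pairing d (bmonom a b * u) F = 0"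
    by (simp add: mult.commute)
next
  assume "\<forall>F\<in>\<Lambda>. \<forall>a b. pairing d (bmonom a b * u) F = 0"
  then have "pairing d (v * u) F = 0" if "F \<in> \<Lambda>" for v F
    using that by (subst pairing_mult_expansion) simp
  then show "u \<in> ann \<Lambda>"
    by (simp add: ann_eq[OF assms] mult.commute)
qed

lemma subspace_ann: "\<Lambda> \<subseteq> bforms d \<Longrightarrow> bp.subspace (ann \<Lambda>)" for \<Lambda> :: "'k::field_char_0 poly poly set"
  by (auto simp: bp.subspace_def ann_eq distrib_right pairing_left bscale_mult_left)

lemma ann_mult: "\<Lambda> \<subseteq> bforms d \<Longrightarrow> u \<in> ann \<Lambda> \<Longrightarrow> u * v \<in> ann \<Lambda>" for \<Lambda> :: "'k::field_char_0 poly poly set"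
  by (simp add: ann_eq mult.assoc)

lemma ann_mult': "\<Lambda> \<subseteq> bforms d \<Longrightarrow> u \<in> ann \<Lambda> \<Longrightarrow> v * u \<in> ann \<Lambda>" for \<Lambda> :: "'k::field_char_0 poly poly set"
  using ann_mult[of \<Lambda> d u v] by (simp add: mult.commute)

text \<open>This is levelness: no socle below degree \<open>d\<close>. The form \<open>c\<close>
  itself pairs to 0 for degree reasons, and every other monomial contains a factor
  \<open>x\<^sub>1\<close> or \<open>x\<^sub>2\<close>.\<close>

lemma ann_level:
  fixes \<Lambda> :: "'k::field_char_0 poly poly set"
  assumes \<Lambda>: "\<Lambda> \<subseteq> bforms d" and c: "c \<in> bforms m" "m < d"
    and xy: "x\<^sub>1 * c \<in> ann \<Lambda>" "x\<^sub>2 * c \<in> ann \<Lambda>"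
  shows "c \<in> ann \<Lambda>"
  unfolding mem_ann_iff[OF \<Lambda>]
proof (intro ballI allI)
  fix F a b assume F: "F \<in> \<Lambda>"
  have zero: "pairing d (u * v) F = 0" if "u \<in> ann \<Lambda>" for u v
    using that F \<Lambda> by (auto simp: ann_eq)
  consider "a = 0" "b = 0" | a' where "a = Suc a'" | b' where "b = Suc b'"
    by (metis not0_implies_Suc)
  then show "pairing d (bmonom a b * c) F = 0"
  proof cases
    case 1
    then show ?thesis
      using c by (simp add: bmonom_0 pairing_eq_0_if_degree_neq)
  next
    case (2 a')
    then have eq: "bmonom a b = x\<^sub>1 * bmonom a' b"
      by (simp add: bmonom_mult)
    show ?thesis
      unfolding eq using zero[OF xy(1), of "bmonom a' b"] by (simp only: mult_ac)
  next
    case (3 b')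
    then have eq: "bmonom a b = x\<^sub>2 * bmonom a b'"
      by (simp add: bmonom_mult)
    show ?thesis
      unfolding eq using zero[OF xy(2), of "bmonom a b'"] by (simp only: mult_ac)
  qed
qed

text \<open>Multiplication by a monomial of positive degree leaves degree \<open>d\<close>, and the
  pairing ignores all other degrees.\<close>

lemma perp_subset_ann:
  assumes "\<Lambda> \<subseteq> bforms d"
  shows "perp d \<Lambda> \<subseteq> ann \<Lambda>"
proof
  fix w assume w: "w \<in> perp d \<Lambda>"
  have "pairing d (bmonom a b * w) F = 0" if F: "F \<in> \<Lambda>" for a b F
  proof (cases "a + b = 0")
    case True
    then show ?thesis
      using w F by (simp add: bmonom_0 perp_def pairing_commute)
  next
    case False
    have "bmonom a b * w \<in> bforms (a + b + d)"
      using w by (intro mult_in_bforms bmonom_in_bforms) (auto simp: perp_def)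
    then show ?thesis
      using False by (intro pairing_eq_0_if_degree_neq) auto
  qed
  then show "w \<in> ann \<Lambda>"
    unfolding mem_ann_iff[OF assms] by blast
qed

section \<open>Graded pieces of the annihilator and the count of minimal generators\<close>

definition ann_forms :: "'k::field poly poly set \<Rightarrow> nat \<Rightarrow> 'k poly poly set"
  where "ann_forms \<Lambda> m = bforms m \<inter> ann \<Lambda>"

lemma subspace_ann_forms: "\<Lambda> \<subseteq> bforms d \<Longrightarrow> bp.subspace (ann_forms \<Lambda> m)" for \<Lambda> :: "'k::field_char_0 poly poly set"
  unfolding ann_forms_def by (intro bp.subspace_inter subspace_bforms subspace_ann)

lemma hilbert_function_ann:
  fixes \<Lambda> :: "'k::field_char_0 poly poly set"
  assumes "\<Lambda> \<subseteq> bforms d"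
  shows "hilbert_function (ann \<Lambda>) i + bp.dim (ann_forms \<Lambda> i) = i + 1"
  unfolding hilbert_function_def ann_forms_def
  using bp.quot_dim_plus_dim[OF subspace_bforms subspace_ann[OF assms] finite_bmonoms bforms_subset_span]
  by (simp add: dim_bforms)

text \<open>With I the annihilator, this is R_1 I_m, the part of I_(m+1) generated in lower degrees;
  a basis of I_(m+1) modulo it consists of minimal generators of degree m+1.\<close>

definition generated_forms :: "'k::field poly poly set \<Rightarrow> nat \<Rightarrow> 'k poly poly set"
  where "generated_forms \<Lambda> m =
    {a + b |a b. a \<in> (*) (x\<^sub>1) ` ann_forms \<Lambda> m \<and> b \<in> (*) (x\<^sub>2) ` ann_forms \<Lambda> m}"

lemma subspace_generated_forms:
  "\<Lambda> \<subseteq> bforms d \<Longrightarrow> bp.subspace (generated_forms \<Lambda> m)" for \<Lambda> :: "'k::field_char_0 poly poly set"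
  unfolding generated_forms_def
  by (intro bp.subspace_sums subspace_times_image subspace_ann_forms)

lemma times_image_ann_forms:
  fixes \<Lambda> :: "'k::field_char_0 poly poly set"
  assumes "\<Lambda> \<subseteq> bforms d" "u \<in> bforms l"
  shows "(*) u ` ann_forms \<Lambda> m \<subseteq> ann_forms \<Lambda> (l + m)"
  using assms ann_mult'[OF assms(1)] mult_in_bforms[OF assms(2)] by (auto simp: ann_forms_def)

lemma generated_forms_subset:
  fixes \<Lambda> :: "'k::field_char_0 poly poly set"
  assumes "\<Lambda> \<subseteq> bforms d"
  shows "generated_forms \<Lambda> m \<subseteq> ann_forms \<Lambda> (Suc m)"
proof
  fix z assume "z \<in> generated_forms \<Lambda> m"
  then obtain a b where "z = a + b" "a \<in> (*) (x\<^sub>1) ` ann_forms \<Lambda> m" "b \<in> (*) (x\<^sub>2) ` ann_forms \<Lambda> m"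
    by (auto simp: generated_forms_def)
  then show "z \<in> ann_forms \<Lambda> (Suc m)"
    using times_image_ann_forms[OF assms xy_in_bforms(1), of m] times_image_ann_forms[OF assms xy_in_bforms(2), of m]
    by (auto intro: bp.subspace_add[OF subspace_ann_forms[OF assms]])
qed

text \<open>The Koszul relation. Comparing coefficients at exponent 0 of the outer variable shows
  that \<open>x\<^sub>2\<close> divides \<open>a\<close>; cancelling it then determines
  \<open>b\<close>.\<close>

lemma xy_syzygy:
  fixes a b :: "'k::field poly poly"
  assumes "x\<^sub>1 * a = x\<^sub>2 * b"
  obtains c where "a = x\<^sub>2 * c" "b = x\<^sub>1 * c"
proof -
  have y: "x\<^sub>2 * p = pCons 0 p" for p :: "'k poly poly"
    by (simp add: bmonom_def monom_altdef flip: one_pCons)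
  obtain k c where a: "a = pCons k c"
    by (cases a)
  have "coeff (x\<^sub>1 * a) 0 = coeff (x\<^sub>2 * b) 0"
    using assms by simp
  then have "k = 0"
    by (simp add: a y bmonom_def coeff_mult monom_eq_0_iff)
  then have ac: "a = x\<^sub>2 * c"
    using a y by simp
  have "x\<^sub>2 * b = x\<^sub>2 * (x\<^sub>1 * c)"
    using assms ac by (simp add: mult.left_commute)
  then have "b = x\<^sub>1 * c"
    by (simp only: mult_left_cancel[OF bmonom_neq_0])
  with ac show ?thesis
    by (rule that)
qed

lemma bforms_of_mult_bmonom:
  assumes "x\<^sub>1 * c \<in> bforms m"
  shows "m = 0 \<and> c = 0 \<or> (\<exists>m'. m = Suc m' \<and> c \<in> bforms m')"
proof -
  have "Suc i + j = m" if "bcoeff c i j \<noteq> 0" for i j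
    using bformsD[OF assms, of "Suc i" j] that by (auto simp: bcoeff_mult_bmonom)
  note deg = this
  show ?thesis
  proof (cases m)
    case 0
    then have "c = 0"
      using deg by (intro bpoly_eqI) fastforce
    with 0 show ?thesis
      by simp
  next
    case (Suc m')
    then show ?thesis
      using deg by (auto simp: bforms_def)
  qed
qed

text \<open>By the Koszul relation an element of both images is
  \<open>x\<^sub>1 * (x\<^sub>2 * c)\<close>, and levelness, available because m - 1 < d, puts
  \<open>c\<close> into I_(m-1). The intersection is thus a copy of I_(m-1), or 0 for m = 0.\<close>

lemma dim_xy_Int:
  fixes \<Lambda> :: "'k::field_char_0 poly poly set"
  assumes \<Lambda>: "\<Lambda> \<subseteq> bforms d" and m: "m \<le> d"
  shows "bp.dim ((*) (x\<^sub>1) ` ann_forms \<Lambda> m \<inter> (*) (x\<^sub>2) ` ann_forms \<Lambda> m)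
    = (if m = 0 then 0 else bp.dim (ann_forms \<Lambda> (m - 1)))" (is "bp.dim (?X \<inter> ?Y) = _")
proof -
  have XY: "\<exists>c m'. z = x\<^sub>1 * (x\<^sub>2 * c) \<and> (c = 0 \<or> m = Suc m' \<and> c \<in> ann_forms \<Lambda> m')"
    if z: "z \<in> ?X" "z \<in> ?Y" for z
  proof -
    from z obtain a b where ab: "z = x\<^sub>1 * a" "z = x\<^sub>2 * b" "a \<in> ann_forms \<Lambda> m" "b \<in> ann_forms \<Lambda> m"
      by blast
    then obtain c where c: "a = x\<^sub>2 * c" "b = x\<^sub>1 * c"
      using xy_syzygy[of a b] by metis
    have "c = 0 \<or> (\<exists>m'. m = Suc m' \<and> c \<in> bforms m')"
      using bforms_of_mult_bmonom[of c m] ab(4) c(2) by (auto simp: ann_forms_def)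
    moreover have "c \<in> ann \<Lambda>" if "c \<in> bforms m'" "m = Suc m'" for m'
      using ann_level[OF \<Lambda> that(1)] that(2) m ab c by (auto simp: ann_forms_def)
    ultimately show ?thesis
      using ab(1) c(1) by (auto simp: ann_forms_def)
  qed
  show ?thesis
  proof (cases m)
    case 0
    then have "?X \<inter> ?Y \<subseteq> bp.span {}"
      using XY by fastforce
    then have "bp.dim (?X \<inter> ?Y) \<le> card ({} :: 'k poly poly set)"
      by (rule bp.dim_le_card) simp
    then show ?thesis
      using 0 by simp
  next
    case (Suc m')
    have xy: "x\<^sub>1 * x\<^sub>2 * c = x\<^sub>1 * (x\<^sub>2 * c)" "x\<^sub>1 * x\<^sub>2 * c = x\<^sub>2 * (x\<^sub>1 * c)"
      for c :: "'k poly poly"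
      by (simp_all only: mult_ac)
    have "?X \<inter> ?Y = (*) (x\<^sub>1 * x\<^sub>2) ` ann_forms \<Lambda> m'"
    proof (intro subset_antisym subsetI)
      fix z assume "z \<in> ?X \<inter> ?Y"
      then show "z \<in> (*) (x\<^sub>1 * x\<^sub>2) ` ann_forms \<Lambda> m'"
        using XY[of z] Suc bp.subspace_0[OF subspace_ann_forms[OF \<Lambda>]] by (auto simp: xy(1))
    next
      fix z assume "z \<in> (*) (x\<^sub>1 * x\<^sub>2) ` ann_forms \<Lambda> m'"
      then obtain c where c: "c \<in> ann_forms \<Lambda> m'" "z = x\<^sub>1 * x\<^sub>2 * c"
        by auto
      have "x\<^sub>1 * c \<in> ann_forms \<Lambda> m" "x\<^sub>2 * c \<in> ann_forms \<Lambda> m"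
        using c(1) times_image_ann_forms[OF \<Lambda> xy_in_bforms(1), of m'] times_image_ann_forms[OF \<Lambda> xy_in_bforms(2), of m'] Suc
        by auto
      then show "z \<in> ?X \<inter> ?Y"
        using c(2) xy by auto
    qed
    moreover have "x\<^sub>1 * x\<^sub>2 \<noteq> (0 :: 'k poly poly)"
      by simp
    ultimately show ?thesis
      using Suc by (simp add: dim_times_image subspace_ann_forms[OF \<Lambda>])
  qed
qed

text \<open>The number is dim I_(m+1) - 2 dim I_m + dim I_(m-1). Since h_i = i + 1 - dim I_i and i +
  1 has zero second difference, this equals e_(m+1).\<close>

lemma generators_exist:
  fixes \<Lambda> :: "'k::field_char_0 poly poly set"
  assumes \<Lambda>: "\<Lambda> \<subseteq> bforms d" and m: "m \<le> d"
  obtains B where "basis_mod bscale (ann_forms \<Lambda> (Suc m)) (generated_forms \<Lambda> m) B" "finite B"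
    "int (card B) = ediff (hilbert_function (ann \<Lambda>)) (Suc m)"
proof -
  let ?I = "ann_forms \<Lambda>" and ?h = "hilbert_function (ann \<Lambda>)"
  let ?X = "(*) (x\<^sub>1) ` ann_forms \<Lambda> m" and ?Y = "(*) (x\<^sub>2) ` ann_forms \<Lambda> m"
  have span: "?I k \<subseteq> bp.span (bmonoms k)" for k
    using bforms_subset_span[of k] by (auto simp: ann_forms_def)
  obtain B where B: "basis_mod bscale (?I (Suc m)) (generated_forms \<Lambda> m) B"
    using bp.basis_mod_exists[OF subspace_ann_forms[OF \<Lambda>] subspace_generated_forms[OF \<Lambda>]] .
  have "?I (Suc m) \<inter> generated_forms \<Lambda> m = generated_forms \<Lambda> m"
    using generated_forms_subset[OF \<Lambda>] by auto
  then have card: "finite B" "card B + bp.dim (generated_forms \<Lambda> m) = bp.dim (?I (Suc m))"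
    using bp.basis_mod_card[OF subspace_ann_forms[OF \<Lambda>] subspace_generated_forms[OF \<Lambda>] finite_bmonoms span B]
    by simp_all
  have "?X \<subseteq> bp.span (bmonoms (Suc m))" "?Y \<subseteq> bp.span (bmonoms (Suc m))"
    using times_image_ann_forms[OF \<Lambda> xy_in_bforms(1), of m] times_image_ann_forms[OF \<Lambda> xy_in_bforms(2), of m]
      span[of "Suc m"] by auto
  then have "bp.dim (generated_forms \<Lambda> m) + bp.dim (?X \<inter> ?Y) = bp.dim ?X + bp.dim ?Y"
    unfolding generated_forms_def
    by (rule bp.dim_sums_Int[OF subspace_times_image[OF subspace_ann_forms[OF \<Lambda>]] finite_bmonoms _
        subspace_times_image[OF subspace_ann_forms[OF \<Lambda>]] finite_bmonoms])
  moreover have "bp.dim ?X = bp.dim (?I m)" "bp.dim ?Y = bp.dim (?I m)"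
    by (intro dim_times_image subspace_ann_forms[OF \<Lambda>] bmonom_neq_0)+
  ultimately have gen: "bp.dim (generated_forms \<Lambda> m) + (if m = 0 then 0 else bp.dim (?I (m - 1))) = 2 * bp.dim (?I m)"
    using dim_xy_Int[OF \<Lambda> m] by simp
  have h: "int (?h i) = int i + 1 - int (bp.dim (?I i))" for i
    using hilbert_function_ann[OF \<Lambda>, of i] by linarith
  \<comment> \<open>For m = 0, the convention h_(-1) = 0 agrees with i + 1 at i = -1.\<close>
  have "int (card B) = ediff ?h (Suc m)"
    using card(2) gen by (cases m) (auto simp: ediff_def h)
  with B card(1) show ?thesis
    by (rule that)
qed

text \<open>A nonzero constant in the annihilator would make it everything and the Hilbert function
  identically 0.\<close>

lemma ann_forms_0:
  fixes \<Lambda> :: "'k::field_char_0 poly poly set"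
  assumes \<Lambda>: "\<Lambda> \<subseteq> bforms d" and h: "hilbert_function (ann \<Lambda>) i \<noteq> 0"
  shows "ann_forms \<Lambda> 0 = {0}"
proof -
  have "c = 0" if c: "c \<in> ann_forms \<Lambda> 0" for c
  proof (rule ccontr)
    assume "c \<noteq> 0"
    define k where "k = bcoeff c 0 0"
    have c_eq: "c = bscale k 1"
      using bforms_expansion[of c 0] c by (simp add: ann_forms_def k_def bmonom_0)
    then have "k \<noteq> 0"
      using \<open>c \<noteq> 0\<close> by auto
    then have "bscale (inverse k) c = 1"
      by (simp add: c_eq)
    then have "1 \<in> ann \<Lambda>"
      using bp.subspace_scale[OF subspace_ann[OF \<Lambda>], of c "inverse k"] c by (simp add: ann_forms_def)
    then have "ann_forms \<Lambda> i = bforms i"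
      using ann_mult[OF \<Lambda>, of 1] by (auto simp: ann_forms_def)
    then show False
      using hilbert_function_ann[OF \<Lambda>, of i] h by (simp add: dim_bforms)
  qed
  then show ?thesis
    using bp.subspace_0[OF subspace_ann_forms[OF \<Lambda>]] by auto
qed

text \<open>Induction on \<open>m\<close> shows that \<open>F\<close> is orthogonal to I_m R_(d-m),
  as I_(m+1) is spanned by \<open>B m\<close> and R_1 I_m. At m = d, \<open>F\<close> is orthogonal
  to the complement of \<open>\<Lambda>\<close>, hence lies in \<open>\<Lambda>\<close>.\<close>

lemma mem_of_perp_generators:
  fixes \<Lambda> :: "'k::field_char_0 poly poly set"
  assumes \<Lambda>: "bp.subspace \<Lambda>" "\<Lambda> \<subseteq> bforms d" and I0: "ann_forms \<Lambda> 0 = {0}"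
    and B: "\<And>m. m < d \<Longrightarrow> basis_mod bscale (ann_forms \<Lambda> (Suc m)) (generated_forms \<Lambda> m) (B m)"
    and F: "F \<in> bforms d" "\<And>m b. m < d \<Longrightarrow> b \<in> B m \<Longrightarrow> F \<in> perp d (multiples d b)"
  shows "F \<in> \<Lambda>"
proof -
  have *: "\<forall>w\<in>ann_forms \<Lambda> m. \<forall>v\<in>bforms (d - m). pairing d (w * v) F = 0" if "m \<le> d" for m
    using that
  proof (induction m)
    case 0
    then show ?case
      by (simp add: I0)
  next
    case (Suc m)
    let ?S = "{w. \<forall>v\<in>bforms (d - Suc m). pairing d (w * v) F = 0}"
    have S: "bp.subspace ?S"
      by (auto simp: bp.subspace_def distrib_right pairing_left bscale_mult_left)
    have "B m \<subseteq> ?S"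
    proof (intro subsetI CollectI ballI)
      fix b v :: "'k poly poly" assume b: "b \<in> B m" and v: "v \<in> bforms (d - Suc m)"
      have "b \<in> bforms (Suc m)"
        using b bp.basis_modD(1)[OF B[of m]] Suc.prems by (auto simp: ann_forms_def)
      then have "b * v \<in> multiples d b"
        using mult_in_bforms[OF _ v, of b "Suc m"] Suc.prems by (simp add: multiples_def)
      then show "pairing d (b * v) F = 0"
        using F(2)[OF _ b] Suc.prems by (simp add: perp_def)
    qed
    moreover have "generated_forms \<Lambda> m \<subseteq> ?S"
    proof (intro subsetI CollectI ballI)
      fix z v :: "'k poly poly" assume "z \<in> generated_forms \<Lambda> m" and v: "v \<in> bforms (d - Suc m)"
      then obtain a b where z: "z = x\<^sub>1 * a + x\<^sub>2 * b" "a \<in> ann_forms \<Lambda> m" "b \<in> ann_forms \<Lambda> m"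
        unfolding generated_forms_def by blast
      \<comment> \<open>The factors \<open>x\<^sub>1\<close> and \<open>x\<^sub>2\<close> move from
        \<open>z\<close> onto \<open>v\<close>, which reduces the claim to degree
        \<open>m\<close>.\<close>
      have "Suc 0 + (d - Suc m) = d - m"
        using Suc.prems by simp
      then have "x\<^sub>1 * v \<in> bforms (d - m)" "x\<^sub>2 * v \<in> bforms (d - m)"
        using mult_in_bforms[OF xy_in_bforms(1) v] mult_in_bforms[OF xy_in_bforms(2) v] by simp_all
      then have "pairing d (a * (x\<^sub>1 * v)) F = 0" "pairing d (b * (x\<^sub>2 * v)) F = 0"
        using Suc z by simp_all
      moreover have "z * v = a * (x\<^sub>1 * v) + b * (x\<^sub>2 * v)"
        by (simp add: z(1) algebra_simps)
      ultimately show "pairing d (z * v) F = 0"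
        by (simp add: pairing_left)
    qed
    ultimately have span: "bp.span (B m \<union> generated_forms \<Lambda> m) \<subseteq> ?S"
      by (intro bp.span_minimal[OF _ S]) simp
    have "m < d"
      using Suc.prems by simp
    from bp.basis_modD(2)[OF B[OF this]] span have "ann_forms \<Lambda> (Suc m) \<subseteq> ?S"
      by (rule subset_trans)
    then show ?case
      by blast
  qed
  show ?thesis
  proof (rule perp_perp[OF \<Lambda> F(1)])
    fix G assume "G \<in> perp d \<Lambda>"
    then have "G \<in> ann_forms \<Lambda> d"
      using perp_subset_ann[OF \<Lambda>(2)] by (auto simp: ann_forms_def perp_def)
    then show "pairing d G F = 0"
      using *[of d] one_in_bforms by fastforce
  qed
qed

section \<open>From generators to secant planes\<close>

lemma subset_perp_multiples:
  assumes "\<Lambda> \<subseteq> bforms d" "u \<in> ann \<Lambda>"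
  shows "\<Lambda> \<subseteq> perp d (multiples d u)"
proof
  fix F assume F: "F \<in> \<Lambda>"
  have "pairing d w F = 0" if "u dvd w" for w
    using that assms F by (auto simp: ann_eq)
  then show "F \<in> perp d (multiples d u)"
    using F assms by (auto simp: perp_def multiples_def)
qed

text \<open>Each index \<open>j\<close> is assigned a minimal generator \<open>u j\<close> of degree
  \<open>q j\<close>, every generator being used once, and its plane is the complement of the
  multiples of \<open>u j\<close>. A generator of degree \<open>d + 1\<close> has no nonzero
  multiple in degree \<open>d\<close> and contributes the whole space.\<close>

lemma intersection_of_secant_planes:
  fixes q :: "'i \<Rightarrow> nat" and \<Lambda> :: "'k::field_char_0 poly poly set"
  assumes \<Lambda>: "bp.subspace \<Lambda>" "\<Lambda> \<subseteq> bforms d"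
    and J: "finite J" "J \<noteq> {}" and q: "q ` J \<subseteq> {1..d + 1}"
    and card: "\<And>i. i \<in> {1..d + 1} \<Longrightarrow> int (card {j \<in> J. q j = i}) = ediff (hilbert_function (ann \<Lambda>)) i"
  shows "\<exists>P. (\<forall>j\<in>J. secant_plane d (q j - 1) (P j)) \<and> PP \<Lambda> = (\<Inter>j\<in>J. P j)"
proof -
  let ?h = "hilbert_function (ann \<Lambda>)"
  have "\<exists>B. \<forall>m\<in>{..d}. basis_mod bscale (ann_forms \<Lambda> (Suc m)) (generated_forms \<Lambda> m) (B m) \<and>
      finite (B m) \<and> int (card (B m)) = ediff ?h (Suc m)"
    by (intro bchoice ballI, rule generators_exist[OF \<Lambda>(2)]) auto
  then obtain B where "\<forall>m\<in>{..d}. basis_mod bscale (ann_forms \<Lambda> (Suc m)) (generated_forms \<Lambda> m) (B m) \<and>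
      finite (B m) \<and> int (card (B m)) = ediff ?h (Suc m)" ..
  then have B: "basis_mod bscale (ann_forms \<Lambda> (Suc m)) (generated_forms \<Lambda> m) (B m)"
    "finite (B m)" "int (card (B m)) = ediff ?h (Suc m)" if "m \<le> d" for m
    using that by auto
  \<comment> \<open>The indices with value \<open>m + 1\<close> and the generators of that degree
    are equally many, namely e_(m+1).\<close>
  have "\<exists>\<beta>. bij_betw \<beta> {j \<in> J. q j = Suc m} (B m)" if m: "m \<le> d" for m
  proof (rule finite_same_card_bij)
    show "card {j \<in> J. q j = Suc m} = card (B m)"
      using card[of "Suc m"] B(3)[OF m] m by simp
  qed (use J B(2)[OF m] in auto)
  then have "\<exists>\<beta>. \<forall>m\<in>{..d}. bij_betw (\<beta> m) {j \<in> J. q j = Suc m} (B m)"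
    by (intro bchoice) simp
  then obtain \<beta> where \<beta>: "\<forall>m\<in>{..d}. bij_betw (\<beta> m) {j \<in> J. q j = Suc m} (B m)" ..
  \<comment> \<open>\<open>B m\<close> holds the generators of degree \<open>m + 1\<close>, hence
    the shift by one.\<close>
  define u where "u j = \<beta> (q j - 1) j" for j
  have uB: "u j \<in> B (q j - 1)" if "j \<in> J" for j
  proof -
    have "q j - 1 \<le> d" "q j = Suc (q j - 1)"
      using q that by fastforce+
    then show ?thesis
      using \<beta> that unfolding u_def by (auto dest!: bspec[of _ _ "q j - 1"] bij_betwE)
  qed
  have surj: "\<exists>j\<in>J. b = u j" if b: "b \<in> B m" and m: "m \<le> d" for b m
  proof -
    have "B m = \<beta> m ` {j \<in> J. q j = Suc m}"
      using \<beta> m by (simp add: bij_betw_def)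
    with b obtain j where "j \<in> J" "q j = Suc m" "b = \<beta> m j"
      by blast
    then show ?thesis
      by (intro bexI[of _ j]) (simp_all add: u_def)
  qed
  have u: "u j \<in> ann_forms \<Lambda> (q j)" "u j \<noteq> 0" if j: "j \<in> J" for j
  proof -
    have qj: "q j - 1 \<le> d" "Suc (q j - 1) = q j"
      using q j by fastforce+
    note basis = B(1)[OF qj(1)]
    show "u j \<in> ann_forms \<Lambda> (q j)"
      using bp.basis_modD(1)[OF basis] uB[OF j] qj(2) by auto
    \<comment> \<open>A zero generator would satisfy a relation with coefficient 1.\<close>
    show "u j \<noteq> 0"
    proof
      assume "u j = 0"
      then show False
        using bp.basis_modD(3)[OF basis, of "{0}" "\<lambda>_. 1" 0] uB[OF j]
          bp.subspace_0[OF subspace_generated_forms[OF \<Lambda>(2)]] by simp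
    qed
  qed
  \<comment> \<open>As \<open>J\<close> is nonempty, some e_i is nonzero, so the Hilbert function is
    not identically 0 and the annihilator contains no nonzero constant.\<close>
  obtain j where "j \<in> J"
    using J by auto
  then have "{k \<in> J. q k = q j} \<noteq> {}" "q j \<in> {1..d + 1}"
    using q by auto
  then have "ediff ?h (q j) \<noteq> 0"
    using card[of "q j"] J by auto
  moreover have "ediff ?h (q j) = 0" if "\<forall>i. ?h i = 0"
    using that by (simp add: ediff_def)
  ultimately obtain i where "?h i \<noteq> 0"
    by blast
  then have I0: "ann_forms \<Lambda> 0 = {0}"
    using \<Lambda>(2) by (intro ann_forms_0)
  have "\<Lambda> = (\<Inter>j\<in>J. perp d (multiples d (u j)))"
  proof (intro subset_antisym subsetI)
    fix F assume "F \<in> \<Lambda>"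
    then show "F \<in> (\<Inter>j\<in>J. perp d (multiples d (u j)))"
      using subset_perp_multiples[OF \<Lambda>(2)] u(1) by (auto simp: ann_forms_def)
  next
    fix F assume F: "F \<in> (\<Inter>j\<in>J. perp d (multiples d (u j)))"
    then have "F \<in> bforms d"
      using J(2) by (auto simp: perp_def)
    show "F \<in> \<Lambda>"
    proof (rule mem_of_perp_generators[OF \<Lambda> I0 _ \<open>F \<in> bforms d\<close>])
      show "basis_mod bscale (ann_forms \<Lambda> (Suc m)) (generated_forms \<Lambda> m) (B m)" if "m < d" for m
        using B(1) that by simp
      show "F \<in> perp d (multiples d b)" if "m < d" "b \<in> B m" for m b
        using surj[OF that(2)] that(1) F by auto
    qed
  qed
  then have "PP \<Lambda> = (\<Inter>j\<in>J. PP (perp d (multiples d (u j))))"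
    using PP_Inter[OF J(2), of "\<lambda>j. perp d (multiples d (u j))"] by (simp add: subspace_perp)
  moreover have "secant_plane d (q j - 1) (PP (perp d (multiples d (u j))))" if "j \<in> J" for j
    using u[OF that] q that by (intro secant_plane_perp_multiples) (auto simp: ann_forms_def)
  ultimately show ?thesis
    by (intro exI[of _ "\<lambda>j. PP (perp d (multiples d (u j)))"]) simp
qed

theorem proposition3p8:
  fixes h q :: "nat \<Rightarrow> nat" and t d :: nat
    and \<Lambda> :: "'k::{alg_closed_field, field_char_0} poly poly set"
  assumes "level_hilbert_function TYPE('k) t d h"
    and "bp.subspace \<Lambda>" "\<Lambda> \<subseteq> bforms d" "bp.dim \<Lambda> = t"
    and "\<forall>i. hilbert_function (ann \<Lambda>) i = h i"
    and "mono_on {1..t + 1} q" "q ` {1..t + 1} \<subseteq> {1..d + 1}"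
    and "\<forall>i\<in>{1..d + 1}. int (card {j \<in> {1..t + 1}. q j = i}) = ediff h i"
  shows "\<exists>P :: nat \<Rightarrow> 'k poly poly set set.
           (\<forall>i\<in>{1..t + 1}. secant_plane d (q i - 1) (P i)) \<and>
           PP \<Lambda> = (\<Inter>i\<in>{1..t + 1}. P i)"
proof -
  have "hilbert_function (ann \<Lambda>) = h"
    using assms(5) by auto
  then show ?thesis
    using assms by (intro intersection_of_secant_planes) auto
qed


end
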